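(* For every integer $t > 0$ there is a strict polynomial-time reduction from the Set Cover problem to the $(s,z,t)$-Temporal Separator problem.
   Context: Set Cover: given a finite universe $U$ and a family $\mathcal{S}$ of subsets of $U$ whose union is $U$, find a minimum-size subfamily of $\mathcal{S}$ whose union is $U$. A temporal graph $G=(V,E,\tau)$ consists of a finite vertex set $V$ and a set of time-labelled undirected edges $E \subseteq V\times V\times[\tau]$ ($(u,v,t')\in E$ iff $(v,u,t')\in E$, no loops). An $(s,z)$-temporal path is a sequence of edges $(u_1,v_1,t_1),\dots,(u_k,v_k,t_k)$ forming a path from $s$ to $z$ with $t_1\le\dots\le t_k$; its travelling time is $t_k-t_1+1$, and it is an $(s,z,t)$-temporal path if this is at most $t$. An $(s,z,t)$-temporal separator is a set $S\subseteq V\setminus\{s,z\}$ meeting every $(s,z,t)$-temporal path. The $(s,z,t)$-Temporal Separator problem: given $G$, $s,z$ and $t$, find a minimum-size $(s,z,t)$-temporal separator. A strict reduction from minimization problem $A$ to minimization problem $B$ consists of polynomial-time maps $f$ (instances of $A$ to instances of $B$) and $g$ (feasible solutions of $f(x)$ to feasible solutions of $x$) such that for every instance $x$ and every feasible solution $y$ of $f(x)$, the ratio of the cost of $g(y)$ to the optimum of $x$ is at most the ratio of the cost of $y$ to the optimum of $f(x)$. *)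

theory Defs
  imports
    "HOL-Computational_Algebra.Polynomial"
    "HOL-Library.Extended_Real"
begin

section \<open>Polynomial time\<close>

text \<open>
  The machine model is the deterministic multi-stack machine over a fixed finite alphabet, presented
  as structured programs. Every step is a push, a pop, or a test of the top of a single stack, and
  costs one unit of time. A tape is a pair of stacks, and conversely a stack is a one-way infinite
  tape with the head at its last symbol; hence running times agree with those of multi-tape Turing
  machines up to a constant factor.
\<close>

datatype sym = Bit bool | Sep | LBr | RBr

type_synonym store = "nat \<Rightarrow> sym list"

definition top_of :: "sym list \<Rightarrow> sym option" where
  "top_of w = (case w of [] \<Rightarrow> None | a # _ \<Rightarrow> Some a)"

text \<open>
  The conditions of \<open>If\<close> and \<open>While\<close> say that the top of stack \<open>k\<close> lies in \<open>A\<close>, where \<open>None\<close> stands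
  for the empty stack. As \<^typ>\<open>sym\<close> is finite, this is a look-up in a constant-size table.
\<close>

datatype prog =
    Skip
  | Push nat sym
  | Pop nat
  | Seq prog prog
  | If nat "sym option set" prog prog
  | While nat "sym option set" prog

text \<open>\<open>exec p \<sigma> n \<sigma>'\<close>: started in \<open>\<sigma>\<close>, program \<open>p\<close> halts after exactly \<open>n\<close> steps in \<open>\<sigma>'\<close>.\<close>

inductive exec :: "prog \<Rightarrow> store \<Rightarrow> nat \<Rightarrow> store \<Rightarrow> bool" where
  Skip: "exec Skip \<sigma> 1 \<sigma>"
| Push: "exec (Push k a) \<sigma> 1 (\<sigma>(k := a # \<sigma> k))"
| Pop: "exec (Pop k) \<sigma> 1 (\<sigma>(k := tl (\<sigma> k)))"
| Seq: "exec p \<sigma> m \<sigma>' \<Longrightarrow> exec q \<sigma>' n \<sigma>'' \<Longrightarrow> exec (Seq p q) \<sigma> (m + n) \<sigma>''"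
| IfTrue: "top_of (\<sigma> k) \<in> A \<Longrightarrow> exec p \<sigma> n \<sigma>' \<Longrightarrow> exec (If k A p q) \<sigma> (1 + n) \<sigma>'"
| IfFalse: "top_of (\<sigma> k) \<notin> A \<Longrightarrow> exec q \<sigma> n \<sigma>' \<Longrightarrow> exec (If k A p q) \<sigma> (1 + n) \<sigma>'"
| WhileFalse: "top_of (\<sigma> k) \<notin> A \<Longrightarrow> exec (While k A p) \<sigma> 1 \<sigma>"
| WhileTrue: "top_of (\<sigma> k) \<in> A \<Longrightarrow> exec p \<sigma> m \<sigma>' \<Longrightarrow> exec (While k A p) \<sigma>' n \<sigma>''
    \<Longrightarrow> exec (While k A p) \<sigma> (1 + m + n) \<sigma>''"

lemma exec_deterministic:
  assumes "exec p \<sigma> m \<sigma>'" and "exec p \<sigma> n \<sigma>''"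
  shows "m = n \<and> \<sigma>' = \<sigma>''"
  using assms
proof (induction arbitrary: n \<sigma>'' rule: exec.induct)
  case (Seq p \<sigma> m \<sigma>1 q n1 \<sigma>2)
  from Seq.prems show ?case
    by (cases rule: exec.cases) (use Seq.IH in blast)+
next
  case (WhileTrue \<sigma> k A p m \<sigma>1 n1 \<sigma>2)
  from WhileTrue.prems show ?case
    by (cases rule: exec.cases) (use WhileTrue.IH WhileTrue.hyps in blast)+
qed (erule exec.cases; auto)+

text \<open>
  The input words are placed on stacks \<open>0, 1, \<dots>\<close> (first symbol on top) and all other stacks are
  empty; the output is the final content of stack \<open>0\<close>.
\<close>

definition load :: "sym list list \<Rightarrow> store" where
  "load ws = (\<lambda>i. if i < length ws then ws ! i else [])"

definition poly_time_on :: "'a set \<Rightarrow> ('a \<Rightarrow> sym list list) \<Rightarrow> ('a \<Rightarrow> sym list) \<Rightarrow> bool" where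
  "poly_time_on X inp out \<longleftrightarrow>
     (\<exists>p. \<exists>q :: nat poly. \<forall>x\<in>X. \<exists>n \<sigma>.
        exec p (load (inp x)) n \<sigma> \<and> \<sigma> 0 = out x \<and>
        n \<le> poly q (sum_list (map length (inp x))))"


section \<open>Encodings\<close>

text \<open>Binary digits, least significant first.\<close>

fun bits_of :: "nat \<Rightarrow> sym list" where
  "bits_of n = (if n = 0 then [] else Bit (odd n) # bits_of (n div 2))"

declare bits_of.simps [simp del]

definition code_nat :: "nat \<Rightarrow> sym list" where
  "code_nat n = bits_of n @ [Sep]"

definition code_list :: "('a \<Rightarrow> sym list) \<Rightarrow> 'a list \<Rightarrow> sym list" where
  "code_list c xs = LBr # concat (map c xs) @ [RBr]"

definition code_prod :: "('a \<Rightarrow> sym list) \<Rightarrow> ('b \<Rightarrow> sym list) \<Rightarrow> 'a \<times> 'b \<Rightarrow> sym list" where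
  "code_prod c d = (\<lambda>(x, y). c x @ d y)"


section \<open>Minimization problems and strict reductions\<close>

record ('i, 's) min_problem =
  instances :: "'i set"
  feasible :: "'i \<Rightarrow> 's set"
  cost :: "'i \<Rightarrow> 's \<Rightarrow> nat"
  inst_code :: "'i \<Rightarrow> sym list"
  sol_code :: "'s \<Rightarrow> sym list"

text \<open>The optimum is only meaningful for instances that have a feasible solution.\<close>

definition opt :: "('i, 's) min_problem \<Rightarrow> 'i \<Rightarrow> nat" where
  "opt P x = (INF y\<in>feasible P x. cost P x y)"

text \<open>
  If the optimum is \<open>0\<close>, optimal solutions have ratio \<open>1\<close> and all others have ratio \<open>\<infinity>\<close>.
\<close>

definition ratio :: "nat \<Rightarrow> nat \<Rightarrow> ereal" where
  "ratio c m = (if m = 0 then (if c = 0 then 1 else \<infinity>) else ereal (real c / real m))"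

text \<open>
  As usual for approximation-preserving reductions, the solution map also sees the instance of the
  source problem, and \<open>f\<close> must not map a solvable instance to an unsolvable one. Without
  the latter requirement the remaining conditions could be satisfied vacuously.
\<close>

definition strict_reduction ::
  "('i, 's) min_problem \<Rightarrow> ('j, 'r) min_problem \<Rightarrow> ('i \<Rightarrow> 'j) \<Rightarrow> ('i \<Rightarrow> 'r \<Rightarrow> 's) \<Rightarrow> bool" where
  "strict_reduction P Q f g \<longleftrightarrow>
     (\<forall>x\<in>instances P.
        f x \<in> instances Q \<and>
        (feasible P x \<noteq> {} \<longrightarrow> feasible Q (f x) \<noteq> {}) \<and>
        (\<forall>y\<in>feasible Q (f x).
           g x y \<in> feasible P x \<and>
           ratio (cost P x (g x y)) (opt P x) \<le> ratio (cost Q (f x) y) (opt Q (f x))))"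

definition strict_poly_time_reducible ::
  "('i, 's) min_problem \<Rightarrow> ('j, 'r) min_problem \<Rightarrow> bool" where
  "strict_poly_time_reducible P Q \<longleftrightarrow>
     (\<exists>f g. strict_reduction P Q f g \<and>
        poly_time_on (instances P) (\<lambda>x. [inst_code P x]) (\<lambda>x. inst_code Q (f x)) \<and>
        poly_time_on {(x, y). x \<in> instances P \<and> y \<in> feasible Q (f x)}
          (\<lambda>(x, y). [inst_code P x, sol_code Q y]) (\<lambda>(x, y). sol_code P (g x y)))"


section \<open>Set Cover\<close>

definition set_system :: "'a set \<Rightarrow> 'a set set \<Rightarrow> bool" where
  "set_system U \<S> \<longleftrightarrow> finite U \<and> \<Union>\<S> = U"

definition set_cover :: "'a set \<Rightarrow> 'a set set \<Rightarrow> 'a set set \<Rightarrow> bool" where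
  "set_cover U \<S> \<C> \<longleftrightarrow> \<C> \<subseteq> \<S> \<and> \<Union>\<C> = U"

text \<open>
  Finite sets of numbers are presented by lists. Neither the order nor repetitions in such a list
  matter for feasibility and cost: an instance \<open>(us, fs)\<close> presents the universe \<open>set us\<close> and the
  family \<open>set ` set fs\<close>, and a solution \<open>cs\<close> presents the subfamily \<open>set ` set cs\<close>.
\<close>

definition set_cover_problem :: "(nat list \<times> nat list list, nat list list) min_problem" where
  "set_cover_problem =
     \<lparr> instances = {(us, fs). set_system (set us) (set ` set fs)},
       feasible = (\<lambda>(us, fs). {cs. set_cover (set us) (set ` set fs) (set ` set cs)}),
       cost = (\<lambda>_ cs. card (set ` set cs)),
       inst_code = code_prod (code_list code_nat) (code_list (code_list code_nat)),
       sol_code = code_list (code_list code_nat) \<rparr>"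


section \<open>Temporal Separator\<close>

type_synonym 'v tedge = "'v \<times> 'v \<times> nat"

record 'v tgraph =
  verts :: "'v set"
  tedges :: "'v tedge set"
  lifetime :: nat

definition temporal_graph :: "'v tgraph \<Rightarrow> bool" where
  "temporal_graph G \<longleftrightarrow>
     finite (verts G) \<and>
     tedges G \<subseteq> verts G \<times> verts G \<times> {1..lifetime G} \<and>
     (\<forall>u v i. (u, v, i) \<in> tedges G \<longleftrightarrow> (v, u, i) \<in> tedges G) \<and>
     (\<forall>u i. (u, u, i) \<notin> tedges G)"

definition tail :: "'v tedge \<Rightarrow> 'v" where "tail = (\<lambda>(u, v, i). u)"
definition head :: "'v tedge \<Rightarrow> 'v" where "head = (\<lambda>(u, v, i). v)"
definition label :: "'v tedge \<Rightarrow> nat" where "label = (\<lambda>(u, v, i). i)"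

definition path_verts :: "'v tedge list \<Rightarrow> 'v list" where
  "path_verts es = tail (hd es) # map head es"

definition temporal_path :: "'v tgraph \<Rightarrow> 'v \<Rightarrow> 'v \<Rightarrow> 'v tedge list \<Rightarrow> bool" where
  "temporal_path G s z es \<longleftrightarrow>
     es \<noteq> [] \<and> set es \<subseteq> tedges G \<and>
     tail (hd es) = s \<and> head (last es) = z \<and>
     (\<forall>i. Suc i < length es \<longrightarrow> head (es ! i) = tail (es ! Suc i)) \<and>
     distinct (path_verts es) \<and>
     sorted (map label es)"

definition travelling_time :: "'v tedge list \<Rightarrow> nat" where
  "travelling_time es = label (last es) - label (hd es) + 1"

definition bounded_temporal_path ::
  "'v tgraph \<Rightarrow> 'v \<Rightarrow> 'v \<Rightarrow> nat \<Rightarrow> 'v tedge list \<Rightarrow> bool" where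
  "bounded_temporal_path G s z t es \<longleftrightarrow> temporal_path G s z es \<and> travelling_time es \<le> t"

definition temporal_separator :: "'v tgraph \<Rightarrow> 'v \<Rightarrow> 'v \<Rightarrow> nat \<Rightarrow> 'v set \<Rightarrow> bool" where
  "temporal_separator G s z t S \<longleftrightarrow>
     S \<subseteq> verts G - {s, z} \<and>
     (\<forall>es. bounded_temporal_path G s z t es \<longrightarrow> S \<inter> set (path_verts es) \<noteq> {})"

text \<open>An instance \<open>(vs, es, \<tau>, s, z)\<close> presents \<open>G = (set vs, set es, \<tau>)\<close> with terminals \<open>s\<close>, \<open>z\<close>.\<close>

type_synonym ts_instance = "nat list \<times> nat tedge list \<times> nat \<times> nat \<times> nat"

definition graph_of :: "nat list \<Rightarrow> nat tedge list \<Rightarrow> nat \<Rightarrow> nat tgraph" where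
  "graph_of vs es \<tau> = \<lparr> verts = set vs, tedges = set es, lifetime = \<tau> \<rparr>"

definition temporal_separator_problem :: "nat \<Rightarrow> (ts_instance, nat list) min_problem" where
  "temporal_separator_problem t =
     \<lparr> instances = {(vs, es, \<tau>, s, z).
         temporal_graph (graph_of vs es \<tau>) \<and> s \<in> set vs \<and> z \<in> set vs \<and> s \<noteq> z},
       feasible = (\<lambda>(vs, es, \<tau>, s, z). {xs. temporal_separator (graph_of vs es \<tau>) s z t (set xs)}),
       cost = (\<lambda>_ xs. card (set xs)),
       inst_code = code_prod (code_list code_nat)
         (code_prod (code_list (code_prod code_nat (code_prod code_nat code_nat)))
           (code_prod code_nat (code_prod code_nat code_nat))),
       sol_code = code_list code_nat \<rparr>"

end

theory Submission imports Defs
begin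

text \<open>
  Give every element \<open>a\<close> of the universe its own time label and let the edges with this label form a
  single path from \<open>s\<close> to \<open>z\<close> through the vertices of exactly those sets that contain \<open>a\<close>. Labels of
  different elements differ by at least \<open>t\<close>, so a path of travelling time at most \<open>t\<close> stays within
  one label and has to visit the whole path of one element. Hence the separators are precisely the
  hitting sets of these paths, that is, the covers.

  The numbering is chosen so that its binary digits are easy to produce: \<open>s\<close> is \<open>0\<close>, \<open>z\<close> is \<open>2\<close>, the
  \<open>j\<close>-th set is \<open>2\<^sup>j - 1\<close> (a block of \<open>j\<close> ones, counted from \<open>j = 1\<close>), and the label of \<open>a\<close> is
  \<open>2\<^sup>t (2 a + 1)\<close>, whose digits are those of \<open>a\<close> behind \<open>t\<close> zeros and a one.
\<close>

section \<open>Programs with time bounds\<close>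

text \<open>The polynomial bound has to be proved for an explicit stack program, and this shapes the
  numbering: the program never calculates. The next vertex costs one pushed symbol, a label is a
  fixed prefix put before digits that are already there, and a bound on all labels comes from
  counting input symbols. Vertices written as blocks of ones lengthen the instance only
  polynomially. The odd factor \<open>2 a + 1\<close> keeps the label of \<open>0\<close> positive,
  whereas zeros alone would be no binary numeral; \<open>2\<close> is the least number not of the
  form \<open>2 ^ j - 1\<close>, so \<open>z\<close> collides with no set. All routes visit the sets
  in list order, so one pass over the family writes one route. Edges are undirected, and a walk
  within one label may run back and forth; it still cannot get past a vertex that it avoids, since
  the edges of that label form a path. Neither translation of solutions increases the cost, so the
  two optima agree.\<close>

definition runs :: "prog \<Rightarrow> store \<Rightarrow> nat \<Rightarrow> store \<Rightarrow> bool" where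
  "runs p \<sigma> n \<sigma>' \<longleftrightarrow> (\<exists>m\<le>n. exec p \<sigma> m \<sigma>')"

text \<open>Branches differ in cost, so exact counts do not compose well and only upper bounds are
  kept. The final store enters through an equation, so that a chain of rules may compute it in any
  form and the comparison is left to the simplifier.\<close>

lemma runs_weaken: "runs p \<sigma> m \<sigma>' \<Longrightarrow> m \<le> n \<Longrightarrow> \<sigma>' = \<sigma>'' \<Longrightarrow> runs p \<sigma> n \<sigma>''"
  unfolding runs_def by (meson le_trans)

lemma runs_Skip: "runs Skip \<sigma> 1 \<sigma>"
  unfolding runs_def by (blast intro: exec.Skip)

lemma runs_Push: "runs (Push k a) \<sigma> 1 (\<sigma>(k := a # \<sigma> k))"
  unfolding runs_def by (blast intro: exec.Push)

lemma runs_Pop: "runs (Pop k) \<sigma> 1 (\<sigma>(k := tl (\<sigma> k)))"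
  unfolding runs_def by (blast intro: exec.Pop)

lemma runs_Seq: "runs p \<sigma> m \<sigma>' \<Longrightarrow> runs q \<sigma>' n \<sigma>'' \<Longrightarrow> runs (Seq p q) \<sigma> (m + n) \<sigma>''"
  unfolding runs_def by (meson add_mono exec.Seq)

lemma runs_If_True:
  "top_of (\<sigma> k) \<in> A \<Longrightarrow> runs p \<sigma> n \<sigma>' \<Longrightarrow> runs (If k A p q) \<sigma> (1 + n) \<sigma>'"
  unfolding runs_def by (meson add_left_mono exec.IfTrue)

lemma runs_If_False:
  "top_of (\<sigma> k) \<notin> A \<Longrightarrow> runs q \<sigma> n \<sigma>' \<Longrightarrow> runs (If k A p q) \<sigma> (1 + n) \<sigma>'"
  unfolding runs_def by (meson add_left_mono exec.IfFalse)

lemma runs_While_False: "top_of (\<sigma> k) \<notin> A \<Longrightarrow> runs (While k A p) \<sigma> 1 \<sigma>"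
  unfolding runs_def by (blast intro: exec.WhileFalse)

lemma runs_While_True:
  "top_of (\<sigma> k) \<in> A \<Longrightarrow> runs p \<sigma> m \<sigma>' \<Longrightarrow> runs (While k A p) \<sigma>' n \<sigma>''
    \<Longrightarrow> runs (While k A p) \<sigma> (1 + m + n) \<sigma>''"
  unfolding runs_def by (meson add_mono order_refl exec.WhileTrue)

lemma top_of_simps [simp]: "top_of [] = None" "top_of (a # w) = Some a"
  by (simp_all add: top_of_def)

section \<open>Loops, case distinction and transfer between stacks\<close>

fun seq :: "prog list \<Rightarrow> prog" where
  "seq [] = Skip"
| "seq (p # ps) = Seq p (seq ps)"

lemma runs_seq_Nil: "runs (seq []) \<sigma> 1 \<sigma>"
  using runs_Skip by simp

lemma runs_seq_Cons:
  "runs p \<sigma> m \<sigma>' \<Longrightarrow> runs (seq ps) \<sigma>' n \<sigma>'' \<Longrightarrow> runs (seq (p # ps)) \<sigma> (m + n) \<sigma>''"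
  by (simp add: runs_Seq)

lemmas runs_basic = runs_seq_Nil runs_seq_Cons runs_Push runs_Pop runs_Skip

text \<open>Here \<open>h a\<close> is the effect of one pass on the symbol \<open>a\<close> and
  \<open>H w\<close> that of the whole loop on \<open>w\<close>; the premises make \<open>H\<close>
  a fold of \<open>h\<close>. The loop stops exactly at \<open>v\<close>, whose top lies outside
  \<open>A\<close>. The extra unit per symbol, and the one at the end, pay for the loop
  tests.\<close>

lemma runs_foreach:
  assumes "\<sigma> k = w @ v" and "\<forall>a\<in>set w. Some a \<in> A" and "top_of v \<notin> A"
    and base: "\<And>\<sigma>. \<sigma> k = v \<Longrightarrow> H [] \<sigma> = \<sigma>"
    and step: "\<And>a w \<sigma>. \<sigma> k = a # w @ v \<Longrightarrow>
      runs p \<sigma> c (h a \<sigma>) \<and> h a \<sigma> k = w @ v \<and> H w (h a \<sigma>) = H (a # w) \<sigma>"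
  shows "runs (While k A p) \<sigma> ((c + 1) * length w + 1) (H w \<sigma>)"
  using assms(1,2)
proof (induction w arbitrary: \<sigma>)
  case Nil
  then show ?case using base[of \<sigma>] assms(3) runs_While_False[of \<sigma> k A p] by simp
next
  case (Cons a w)
  have *: "runs p \<sigma> c (h a \<sigma>)" "h a \<sigma> k = w @ v" "H w (h a \<sigma>) = H (a # w) \<sigma>"
    using step[of \<sigma> a w] Cons.prems(1) by simp_all
  have "runs (While k A p) \<sigma> (1 + c + ((c + 1) * length w + 1)) (H w (h a \<sigma>))"
    by (rule runs_While_True[OF _ *(1) Cons.IH[of "h a \<sigma>", OF *(2)]]) (use Cons.prems in simp_all)
  then show ?case by (simp add: *(3) add_ac)
qed

text \<open>A test cannot bind the symbol it reads, so a program depending on that symbol has to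
  branch over the whole alphabet. An empty stack would end in the branch of \<open>RBr\<close>; the
  rule below therefore asks for a nonempty one.\<close>

definition dispatch :: "nat \<Rightarrow> (sym \<Rightarrow> prog) \<Rightarrow> prog" where
  "dispatch k p = If k {Some (Bit False)} (p (Bit False)) (If k {Some (Bit True)} (p (Bit True))
     (If k {Some Sep} (p Sep) (If k {Some LBr} (p LBr) (p RBr))))"

lemma runs_dispatch:
  assumes "\<sigma> k = a # w" and "runs (p a) \<sigma> n \<sigma>'"
  shows "runs (dispatch k p) \<sigma> (n + 4) \<sigma>'"
proof -
  have le: "runs (p a) \<sigma> m \<sigma>'" if "n \<le> m" for m
    using runs_weaken[OF assms(2) that] by simp
  have runs_If: "runs (If k A p q) \<sigma> (Suc n) \<sigma>'"
    if "top_of (\<sigma> k) \<in> A \<Longrightarrow> runs p \<sigma> n \<sigma>'" "top_of (\<sigma> k) \<notin> A \<Longrightarrow> runs q \<sigma> n \<sigma>'" for A p q n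
    using that runs_If_True[of \<sigma> k A p n \<sigma>' q] runs_If_False[of \<sigma> k A q n \<sigma>' p] by auto
  have "runs (dispatch k p) \<sigma> (Suc (Suc (Suc (Suc n)))) \<sigma>'"
    unfolding dispatch_def using le assms(1)
    by (intro runs_If; cases a rule: sym.exhaust) auto
  then show ?thesis by (simp add: numeral_eq_Suc)
qed

definition move :: "nat \<Rightarrow> nat \<Rightarrow> prog" where
  "move k l = dispatch k (\<lambda>a. seq [Pop k, Push l a])"

lemma runs_move:
  assumes "\<sigma> k = a # w" and "k \<noteq> l"
  shows "runs (move k l) \<sigma> 7 (\<sigma>(k := w, l := a # \<sigma> l))"
  unfolding move_def
  by (rule runs_weaken, rule runs_dispatch, rule assms, (rule runs_basic)+) (use assms in simp_all)

lemma runs_move_hd: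
  "\<sigma> k \<noteq> [] \<Longrightarrow> k \<noteq> l \<Longrightarrow> runs (move k l) \<sigma> 7 (\<sigma>(k := tl (\<sigma> k), l := hd (\<sigma> k) # \<sigma> l))"
  by (rule runs_move) auto

definition moves :: "nat \<Rightarrow> sym option set \<Rightarrow> nat \<Rightarrow> prog" where
  "moves k A l = While k A (move k l)"

text \<open>Two uses of \<open>f\<close> matter: with \<open>id\<close> it duplicates a word, with a
  constant it measures the length of a word in unary.\<close>

definition moves2 :: "nat \<Rightarrow> sym option set \<Rightarrow> nat \<Rightarrow> nat \<Rightarrow> (sym \<Rightarrow> sym) \<Rightarrow> prog" where
  "moves2 k A l m f = While k A (dispatch k (\<lambda>a. seq [Pop k, Push l a, Push m (f a)]))"

lemma runs_moves:
  assumes "\<sigma> k = w @ v" and "\<forall>a\<in>set w. Some a \<in> A" and "top_of v \<notin> A" and "k \<noteq> l"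
  shows "runs (moves k A l) \<sigma> (8 * length w + 1) (\<sigma>(k := v, l := rev w @ \<sigma> l))"
proof -
  define h where "h a \<sigma> = \<sigma>(k := tl (\<sigma> k), l := a # \<sigma> l)" for a and \<sigma> :: store
  define H where "H w \<sigma> = \<sigma>(k := v, l := rev w @ \<sigma> l)" for w and \<sigma> :: store
  have "runs (moves k A l) \<sigma> ((7 + 1) * length w + 1) (H w \<sigma>)"
    unfolding moves_def
  proof (rule runs_foreach[where h = h and H = H and \<sigma> = \<sigma> and k = k and w = w and v = v, OF assms(1-3)])
    fix \<sigma> :: store and a w
    assume *: "\<sigma> k = a # w @ v"
    have "runs (move k l) \<sigma> 7 (h a \<sigma>)"
      by (rule runs_weaken, rule runs_move, rule *, rule assms) (simp_all add: h_def *)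
    then show "runs (move k l) \<sigma> 7 (h a \<sigma>) \<and> h a \<sigma> k = w @ v \<and> H w (h a \<sigma>) = H (a # w) \<sigma>"
      using * assms(4) by (auto simp: h_def H_def fun_eq_iff)
  qed (simp add: H_def fun_eq_iff)
  then show ?thesis by (simp add: H_def)
qed

lemma runs_moves2:
  assumes "\<sigma> k = w @ v" and "\<forall>a\<in>set w. Some a \<in> A" and "top_of v \<notin> A" and "distinct [k, l, m]"
  shows "runs (moves2 k A l m f) \<sigma> (9 * length w + 1)
    (\<sigma>(k := v, l := rev w @ \<sigma> l, m := rev (map f w) @ \<sigma> m))"
proof -
  let ?p = "dispatch k (\<lambda>a. seq [Pop k, Push l a, Push m (f a)])"
  define h where "h a \<sigma> = \<sigma>(k := tl (\<sigma> k), l := a # \<sigma> l, m := f a # \<sigma> m)" for a and \<sigma> :: store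
  define H where "H w \<sigma> = \<sigma>(k := v, l := rev w @ \<sigma> l, m := rev (map f w) @ \<sigma> m)" for w and \<sigma> :: store
  have "runs (moves2 k A l m f) \<sigma> ((8 + 1) * length w + 1) (H w \<sigma>)"
    unfolding moves2_def
  proof (rule runs_foreach[where h = h and H = H and \<sigma> = \<sigma> and k = k and w = w and v = v, OF assms(1-3)])
    fix \<sigma> :: store and a w
    assume *: "\<sigma> k = a # w @ v"
    have "runs ?p \<sigma> 8 (h a \<sigma>)"
      by (rule runs_weaken, rule runs_dispatch, rule *, (rule runs_basic)+)
        (use assms(4) in \<open>simp_all add: h_def\<close>)
    then show "runs ?p \<sigma> 8 (h a \<sigma>) \<and> h a \<sigma> k = w @ v \<and> H w (h a \<sigma>) = H (a # w) \<sigma>"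
      using * assms(4) by (auto simp: h_def H_def fun_eq_iff)
  qed (simp add: H_def fun_eq_iff)
  then show ?thesis by (simp add: H_def)
qed

definition clear :: "nat \<Rightarrow> prog" where
  "clear k = While k (range Some) (Pop k)"

lemma runs_clear: "runs (clear k) \<sigma> (2 * length (\<sigma> k) + 1) (\<sigma>(k := []))"
proof -
  define h where "h a \<sigma> = \<sigma>(k := tl (\<sigma> k))" for a :: sym and \<sigma> :: store
  define H where "H w \<sigma> = \<sigma>(k := [])" for w :: "sym list" and \<sigma> :: store
  have "runs (clear k) \<sigma> ((1 + 1) * length (\<sigma> k) + 1) (H (\<sigma> k) \<sigma>)"
    unfolding clear_def
    by (rule runs_foreach[where h = h and v = "[]"])
      (auto simp: h_def H_def fun_eq_iff intro: runs_weaken[OF runs_Pop])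
  then show ?thesis by (simp add: H_def mult_2)
qed

definition move_all :: "nat \<Rightarrow> nat \<Rightarrow> prog" where
  "move_all k l = moves k (range Some) l"

lemma runs_move_all:
  "k \<noteq> l \<Longrightarrow> runs (move_all k l) \<sigma> (8 * length (\<sigma> k) + 1) (\<sigma>(k := [], l := rev (\<sigma> k) @ \<sigma> l))"
  unfolding move_all_def by (rule runs_moves) auto

text \<open>Reading a stack destroys it, hence the detour through \<open>tmp\<close>. The word
  arrives on \<open>l\<close> reversed, which suits an output stack that holds the text written so
  far back to front; on blocks of ones the reversal is invisible.\<close>

definition copy :: "nat \<Rightarrow> nat \<Rightarrow> nat \<Rightarrow> prog" where
  "copy k l tmp = seq [moves2 k (range Some) l tmp id, move_all tmp k]"

lemma runs_copy:
  assumes "\<sigma> tmp = []" and "distinct [k, l, tmp]"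
  shows "runs (copy k l tmp) \<sigma> (17 * length (\<sigma> k) + 3) (\<sigma>(l := rev (\<sigma> k) @ \<sigma> l))"
proof -
  let ?\<sigma> = "\<sigma>(k := [], l := rev (\<sigma> k) @ \<sigma> l, tmp := rev (map id (\<sigma> k)) @ \<sigma> tmp)"
  have 1: "runs (moves2 k (range Some) l tmp id) \<sigma> (9 * length (\<sigma> k) + 1) ?\<sigma>"
    by (rule runs_moves2) (use assms in auto)
  have 2: "runs (move_all tmp k) ?\<sigma> (8 * length (?\<sigma> tmp) + 1) (?\<sigma>(tmp := [], k := rev (?\<sigma> tmp) @ ?\<sigma> k))"
    by (rule runs_move_all) (use assms in auto)
  show ?thesis
    unfolding copy_def
    by (rule runs_weaken, rule runs_seq_Cons[OF 1], rule runs_seq_Cons[OF 2], rule runs_seq_Nil)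
      (use assms in \<open>auto simp: fun_eq_iff\<close>)
qed

section \<open>Binary numerals\<close>

lemma bits_of_0 [simp]: "bits_of 0 = []"
  by (simp add: bits_of.simps)

lemma bits_of_double: "n > 0 \<Longrightarrow> bits_of (2 * n) = Bit False # bits_of n"
  by (subst bits_of.simps) simp

lemma bits_of_Suc_double: "bits_of (Suc (2 * n)) = Bit True # bits_of n"
  by (subst bits_of.simps) simp

lemma bits_of_2: "bits_of 2 = [Bit False, Bit True]"
  using bits_of_double[of 1] bits_of_Suc_double[of 0] by simp

lemma bits_of_power_mult: "n > 0 \<Longrightarrow> bits_of (2 ^ k * n) = replicate k (Bit False) @ bits_of n"
  by (induction k) (simp_all add: mult.assoc bits_of_double)

lemma bits_of_mask: "bits_of (2 ^ k - 1) = replicate k (Bit True)"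
proof (induction k)
  case (Suc k)
  have "(2::nat) ^ Suc k - 1 = Suc (2 * (2 ^ k - 1))"
    using one_le_power[of "2::nat" k] unfolding power_Suc by linarith
  then show ?case using Suc.IH by (simp only: bits_of_Suc_double) simp
qed simp

lemma set_bits_of: "set (bits_of n) \<subseteq> range Bit"
  by (induction n rule: bits_of.induct) (subst bits_of.simps, auto)

lemma inj_bits_of: "inj bits_of"
proof (rule injI)
  show "m = n" if "bits_of m = bits_of n" for m n
    using that
  proof (induction m arbitrary: n rule: bits_of.induct)
    case (1 m)
    show ?case
    proof (cases "m = 0 \<or> n = 0")
      case True
      then show ?thesis
        using "1.prems" by (auto simp: bits_of.simps[of m] bits_of.simps[of n] split: if_splits)
    next
      case False
      then have "odd m = odd n" "bits_of (m div 2) = bits_of (n div 2)"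
        using "1.prems" by (auto simp: bits_of.simps[of m] bits_of.simps[of n])
      moreover from this have "m div 2 = n div 2"
        using "1.IH" False by blast
      ultimately show ?thesis
        by (metis bit_eq_rec)
    qed
  qed
qed

lemma less_two_power_length_bits_of: "n < 2 ^ length (bits_of n)"
proof (induction n rule: bits_of.induct)
  case (1 n)
  show ?case
  proof (cases "n = 0")
    case False
    then have "n div 2 < 2 ^ length (bits_of (n div 2))" using 1 by simp
    then have "n < 2 * 2 ^ length (bits_of (n div 2))" by linarith
    then show ?thesis using False by (subst bits_of.simps) simp
  qed simp
qed

abbreviation digits :: "sym option set" where
  "digits \<equiv> Some ` range Bit"

lemma bits_of_in_digits: "\<forall>a\<in>set (bits_of n). Some a \<in> digits"
  using set_bits_of by blast

lemma code_nat_symbols: "set (code_nat n) \<subseteq> insert Sep (range Bit)"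
  using set_bits_of by (auto simp: code_nat_def)

text \<open>Brackets never occur within a list of numbers, so a scan for the next \<open>RBr\<close>
  finds the end of a set without parsing its elements.\<close>

lemma code_nats_symbols: "set (concat (map code_nat ns)) \<subseteq> insert Sep (range Bit)"
  using code_nat_symbols by auto

definition pushes :: "nat \<Rightarrow> sym list \<Rightarrow> prog" where
  "pushes k w = seq (map (Push k) w)"

lemma runs_pushes: "runs (pushes k w) \<sigma> (length w + 1) (\<sigma>(k := rev w @ \<sigma> k))"
proof (induction w arbitrary: \<sigma>)
  case (Cons a w)
  show ?case
    unfolding pushes_def list.map
    by (rule runs_weaken, rule runs_seq_Cons, rule runs_Push, rule Cons.IH[unfolded pushes_def])
      (auto simp: fun_eq_iff)
qed (simp add: pushes_def runs_Skip[simplified])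

section \<open>A program for the instance map\<close>

text \<open>
  Stacks: \<open>0\<close> the sets not yet scanned and \<open>3\<close> the scanned ones (reversed), \<open>1\<close> the remaining elements
  of the universe (reversed), \<open>2\<close> the digits of the current element, \<open>4\<close> scratch space, \<open>5\<close> nonempty
  after a mismatch of digits, \<open>6\<close> nonempty if the current element was found in the current set,
  \<open>7\<close> the current and \<open>8\<close> the previous vertex on the route, \<open>9\<close> and \<open>10\<close> the code of the edges and of
  the vertices (reversed), \<open>11\<close> the lifetime, a block of ones as long as any label.
\<close>

definition compare :: prog where
  "compare = While 0 digits
     (seq [dispatch 0 (\<lambda>c. If 2 {Some c} (move 2 4) (Push 5 Sep)), move 0 3])"

text \<open>After a mismatch the loop may still consume digits from stack \<open>2\<close>. This is
  harmless, since the mark on stack \<open>5\<close> stays; without a mark, \<open>b\<close> is a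
  prefix of the word on stack \<open>2\<close> and \<open>y\<close> is what remains of it. Consumed
  digits are kept in \<open>x\<close>, so the word can be restored.\<close>

lemma runs_compare:
  assumes "set b \<subseteq> range Bit" and "\<sigma> 0 = b @ v" and "top_of v \<notin> digits"
  shows "\<exists>x y e. runs compare \<sigma> (21 * length b + 1)
      (\<sigma>(0 := v, 3 := rev b @ \<sigma> 3, 2 := y, 4 := x @ \<sigma> 4, 5 := e @ \<sigma> 5)) \<and>
    rev x @ y = \<sigma> 2 \<and> length x \<le> length b \<and> length e \<le> length b \<and>
    (e = [] \<and> y = [] \<longleftrightarrow> \<sigma> 2 = b)"
  using assms(1,2)
proof (induction b arbitrary: \<sigma>)
  case Nil
  have base: "runs compare \<sigma> 1 \<sigma>"
    unfolding compare_def by (rule runs_While_False) (use Nil assms(3) in simp)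
  show ?case
    by (rule exI[of _ "[]"], rule exI[of _ "\<sigma> 2"], rule exI[of _ "[]"])
      (use base Nil in \<open>simp add: fun_upd_idem\<close>)
next
  case (Cons c b)
  let ?p = "\<lambda>c. If 2 {Some c} (move 2 4) (Push 5 Sep)"
  have c: "top_of (\<sigma> 0) \<in> digits" and b: "set b \<subseteq> range Bit" using Cons.prems by auto
  show ?case
  proof (cases "top_of (\<sigma> 2) = Some c")
    case True
    then obtain a where a: "\<sigma> 2 = c # a" by (cases "\<sigma> 2") auto
    define \<rho> where "\<rho> = \<sigma>(0 := b @ v, 2 := a, 3 := c # \<sigma> 3, 4 := c # \<sigma> 4)"
    have "runs (seq [dispatch 0 ?p, move 0 3]) \<sigma> 20 \<rho>"
      by (rule runs_weaken, rule runs_seq_Cons, rule runs_dispatch, rule Cons.prems(2)[simplified],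
          rule runs_If_True, simp add: a, rule runs_move, rule a, simp,
          (rule runs_seq_Cons runs_seq_Nil runs_move_hd | (simp add: Cons.prems; fail))+)
        (auto simp: Cons.prems \<rho>_def fun_eq_iff)
    note step = this
    have \<rho>0: "\<rho> 0 = b @ v" by (simp add: \<rho>_def)
    obtain x y e where IH: "runs compare \<rho> (21 * length b + 1)
        (\<rho>(0 := v, 3 := rev b @ \<rho> 3, 2 := y, 4 := x @ \<rho> 4, 5 := e @ \<rho> 5))"
      "rev x @ y = \<rho> 2" "length x \<le> length b" "length e \<le> length b" "e = [] \<and> y = [] \<longleftrightarrow> \<rho> 2 = b"
      using Cons.IH[of \<rho>, OF b] by (metis (no_types, lifting) \<rho>0)
    have run: "runs compare \<sigma> (21 * length (c # b) + 1)
        (\<sigma>(0 := v, 3 := rev (c # b) @ \<sigma> 3, 2 := y, 4 := (x @ [c]) @ \<sigma> 4, 5 := e @ \<sigma> 5))"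
      unfolding compare_def
      by (rule runs_weaken, rule runs_While_True[OF c step], rule IH(1)[unfolded compare_def])
        (auto simp: \<rho>_def fun_eq_iff)
    show ?thesis
      by (rule exI[of _ "x @ [c]"], rule exI[of _ y], rule exI[of _ e], intro conjI, rule run)
        (use IH(2-) a in \<open>auto simp: \<rho>_def\<close>)
  next
    case False
    define \<rho> where "\<rho> = \<sigma>(0 := b @ v, 3 := c # \<sigma> 3, 5 := Sep # \<sigma> 5)"
    have "runs (seq [dispatch 0 ?p, move 0 3]) \<sigma> 20 \<rho>"
      by (rule runs_weaken, rule runs_seq_Cons, rule runs_dispatch, rule Cons.prems(2)[simplified],
          rule runs_If_False, simp add: False, rule runs_Push,
          (rule runs_seq_Cons runs_seq_Nil runs_move_hd | (simp add: Cons.prems; fail))+)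
        (auto simp: Cons.prems \<rho>_def fun_eq_iff)
    note step = this
    have \<rho>0: "\<rho> 0 = b @ v" by (simp add: \<rho>_def)
    obtain x y e where IH: "runs compare \<rho> (21 * length b + 1)
        (\<rho>(0 := v, 3 := rev b @ \<rho> 3, 2 := y, 4 := x @ \<rho> 4, 5 := e @ \<rho> 5))"
      "rev x @ y = \<rho> 2" "length x \<le> length b" "length e \<le> length b" "e = [] \<and> y = [] \<longleftrightarrow> \<rho> 2 = b"
      using Cons.IH[of \<rho>, OF b] by (metis (no_types, lifting) \<rho>0)
    have run: "runs compare \<sigma> (21 * length (c # b) + 1)
        (\<sigma>(0 := v, 3 := rev (c # b) @ \<sigma> 3, 2 := y, 4 := x @ \<sigma> 4, 5 := (e @ [Sep]) @ \<sigma> 5))"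
      unfolding compare_def
      by (rule runs_weaken, rule runs_While_True[OF c step], rule IH(1)[unfolded compare_def])
        (auto simp: \<rho>_def fun_eq_iff)
    show ?thesis
      by (rule exI[of _ x], rule exI[of _ y], rule exI[of _ "e @ [Sep]"], intro conjI, rule run)
        (use IH(2-) False in \<open>auto simp: \<rho>_def\<close>)
  qed
qed

definition flag :: "bool \<Rightarrow> sym list" where
  "flag c = (if c then [Sep] else [])"

definition test_element :: prog where
  "test_element = seq [compare,
     If 2 {None} (If 5 {None} (If 6 {None} (Push 6 Sep) Skip) Skip) Skip,
     clear 5, move_all 4 2, move 0 3]"

text \<open>Equality means that stack \<open>2\<close> is exhausted and stack \<open>5\<close> shows
  no mismatch. The test of stack \<open>6\<close> keeps the flag at one symbol even if an element is
  repeated. Per digit the cost is 21 for comparing, 2 for clearing and 8 for restoring; the constant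
  overhead is charged to the separator.\<close>

lemma runs_test_element:
  assumes "\<sigma> 0 = code_nat b @ v" and "\<sigma> 2 = bits_of a" and "\<sigma> 4 = []" "\<sigma> 5 = []" "\<sigma> 6 = flag c"
  shows "runs test_element \<sigma> (31 * length (code_nat b))
    (\<sigma>(0 := v, 3 := rev (code_nat b) @ \<sigma> 3, 6 := flag (c \<or> a = b)))"
proof -
  obtain x y e where *: "runs compare \<sigma> (21 * length (bits_of b) + 1)
      (\<sigma>(0 := Sep # v, 3 := rev (bits_of b) @ \<sigma> 3, 2 := y, 4 := x @ \<sigma> 4, 5 := e @ \<sigma> 5))"
    "rev x @ y = bits_of a" "length x \<le> length (bits_of b)" "length e \<le> length (bits_of b)"
    "e = [] \<and> y = [] \<longleftrightarrow> a = b"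
    using runs_compare[of "bits_of b" \<sigma> "Sep # v"] set_bits_of assms
    by (auto simp: code_nat_def inj_eq[OF inj_bits_of])
  define \<rho> where "\<rho> = \<sigma>(0 := Sep # v, 3 := rev (bits_of b) @ \<sigma> 3, 2 := y, 4 := x, 5 := e)"
  have 1: "runs compare \<sigma> (21 * length (bits_of b) + 1) \<rho>"
    using *(1) assms by (simp add: \<rho>_def)
  let ?If = "If 2 {None} (If 5 {None} (If 6 {None} (Push 6 Sep) Skip) Skip) Skip"
  have 2: "runs ?If \<rho> 4 (\<rho>(6 := flag (c \<or> a = b)))"
  proof (cases "y = [] \<and> e = [] \<and> \<not> c")
    case True
    show ?thesis
      by (rule runs_weaken, (rule runs_If_True, simp add: \<rho>_def assms True flag_def)+, rule runs_Push)
        (use True *(5) in \<open>auto simp: \<rho>_def assms flag_def\<close>)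
  next
    case False
    have "\<rho>(6 := flag (c \<or> a = b)) = \<rho>"
      using False *(5) assms by (auto simp: \<rho>_def fun_upd_idem_iff)
    moreover have "runs ?If \<rho> 4 \<rho>"
    proof -
      consider "y \<noteq> []" | "y = []" "e \<noteq> []" | "y = []" "e = []" "c" using False by blast
      then show ?thesis
        by cases (rule runs_weaken, (rule runs_If_True, (simp add: \<rho>_def; fail) | rule runs_If_False,
          (auto simp: \<rho>_def top_of_def assms flag_def split: list.split)[] | rule runs_Skip)+, simp_all)+
    qed
    ultimately show ?thesis by simp
  qed
  show ?thesis
    unfolding test_element_def
    by (rule runs_weaken, rule runs_seq_Cons[OF 1], rule runs_seq_Cons[OF 2],
        (rule runs_seq_Cons runs_seq_Nil runs_clear runs_move_all runs_move_hd
          | (simp add: \<rho>_def; fail))+)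
      (use * assms in \<open>auto simp: \<rho>_def fun_eq_iff code_nat_def\<close>)
qed

definition test_member :: prog where
  "test_member = While 0 (insert (Some Sep) digits) test_element"

lemma runs_test_member:
  assumes "\<sigma> 0 = concat (map code_nat S) @ RBr # v" and "\<sigma> 2 = bits_of a"
    and "\<sigma> 4 = []" "\<sigma> 5 = []" "\<sigma> 6 = flag c"
  shows "runs test_member \<sigma> (32 * length (concat (map code_nat S)) + 1)
    (\<sigma>(0 := RBr # v, 3 := rev (concat (map code_nat S)) @ \<sigma> 3, 6 := flag (c \<or> a \<in> set S)))"
  using assms
proof (induction S arbitrary: \<sigma> c)
  case Nil
  have "runs test_member \<sigma> 1 \<sigma>"
    unfolding test_member_def by (rule runs_While_False) (use Nil in auto)
  then show ?case using Nil by (simp add: fun_upd_idem)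
next
  case (Cons b S)
  have 0: "top_of (\<sigma> 0) \<in> insert (Some Sep) digits"
    using Cons.prems(1) set_bits_of[of b] by (cases "bits_of b") (auto simp: code_nat_def)
  let ?\<rho> = "\<sigma>(0 := concat (map code_nat S) @ RBr # v, 3 := rev (code_nat b) @ \<sigma> 3,
    6 := flag (c \<or> a = b))"
  have 1: "runs test_element \<sigma> (31 * length (code_nat b)) ?\<rho>"
    by (rule runs_test_element) (use Cons.prems in auto)
  have 2: "runs test_member ?\<rho> (32 * length (concat (map code_nat S)) + 1)
    (?\<rho>(0 := RBr # v, 3 := rev (concat (map code_nat S)) @ ?\<rho> 3, 6 := flag ((c \<or> a = b) \<or> a \<in> set S)))"
    by (rule Cons.IH) (use Cons.prems in auto)
  show ?case
    unfolding test_member_def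
    by (rule runs_weaken, rule runs_While_True[OF 0 1 2[unfolded test_member_def]])
      (auto simp: fun_eq_iff code_nat_def[of b])
qed

section \<open>Writing the edges of one route\<close>

definition vertex :: "nat \<Rightarrow> nat" where
  "vertex p = 2 ^ p - 1"

definition time_of :: "nat \<Rightarrow> nat \<Rightarrow> nat" where
  "time_of t a = 2 ^ t * Suc (2 * a)"

lemma bits_of_vertex: "bits_of (vertex p) = replicate p (Bit True)"
  unfolding vertex_def by (rule bits_of_mask)

lemma bits_of_time_of: "bits_of (time_of t a) = replicate t (Bit False) @ Bit True # bits_of a"
  by (simp add: time_of_def bits_of_power_mult bits_of_Suc_double del: mult_Suc_right)

definition code_edge :: "nat tedge \<Rightarrow> sym list" where
  "code_edge = code_prod code_nat (code_prod code_nat code_nat)"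

text \<open>As \<open>t\<close> is fixed, the \<open>t\<close> zeros and the one that precede the
  digits of the element belong to the program text.\<close>

definition emit :: "nat \<Rightarrow> nat \<Rightarrow> nat \<Rightarrow> prog" where
  "emit t k l = seq [copy k 9 4, Push 9 Sep, copy l 9 4,
     pushes 9 (Sep # replicate t (Bit False) @ [Bit True]), copy 2 9 4, Push 9 Sep]"

lemma runs_emit:
  assumes "\<sigma> k = bits_of u" "\<sigma> l = bits_of v" "\<sigma> 2 = bits_of a" "\<sigma> 4 = []"
    and "k \<notin> {4, 9}" "l \<notin> {4, 9}"
  shows "runs (emit t k l) \<sigma>
    (17 * (length (\<sigma> k) + length (\<sigma> l) + length (\<sigma> 2)) + t + 15)
    (\<sigma>(9 := rev (code_edge (u, v, time_of t a)) @ \<sigma> 9))"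
  unfolding emit_def
  by (rule runs_weaken, (rule runs_basic runs_copy runs_pushes | (use assms in \<open>simp; fail\<close>))+)
    (use assms in \<open>auto simp: fun_eq_iff code_edge_def code_prod_def code_nat_def bits_of_time_of\<close>)

definition emit_both :: "nat \<Rightarrow> prog" where
  "emit_both t = seq [emit t 8 7, emit t 7 8]"

lemma runs_emit_both:
  assumes "\<sigma> 8 = bits_of u" "\<sigma> 7 = bits_of v" "\<sigma> 2 = bits_of a" "\<sigma> 4 = []"
  shows "runs (emit_both t) \<sigma>
    (34 * (length (\<sigma> 8) + length (\<sigma> 7) + length (\<sigma> 2)) + 2 * t + 31)
    (\<sigma>(9 := rev (concat (map code_edge [(u, v, time_of t a), (v, u, time_of t a)])) @ \<sigma> 9))"
proof -
  let ?\<rho> = "\<sigma>(9 := rev (code_edge (u, v, time_of t a)) @ \<sigma> 9)"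
  have 1: "runs (emit t 8 7) \<sigma> (17 * (length (\<sigma> 8) + length (\<sigma> 7) + length (\<sigma> 2)) + t + 15) ?\<rho>"
    by (rule runs_emit) (use assms in auto)
  have 2: "runs (emit t 7 8) ?\<rho> (17 * (length (?\<rho> 7) + length (?\<rho> 8) + length (?\<rho> 2)) + t + 15)
      (?\<rho>(9 := rev (code_edge (v, u, time_of t a)) @ ?\<rho> 9))"
    by (rule runs_emit) (use assms in auto)
  show ?thesis
    unfolding emit_both_def
    by (rule runs_weaken, rule runs_seq_Cons[OF 1], rule runs_seq_Cons[OF 2], rule runs_seq_Nil) auto
qed

text \<open>One more \<open>Bit True\<close> turns \<open>vertex j\<close> into
  \<open>vertex (Suc j)\<close>. Stack \<open>8\<close> is overwritten only when the set contains
  the element, so every edge joins consecutive hits.\<close>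

definition scan_set :: "nat \<Rightarrow> prog" where
  "scan_set t = seq [move 0 3, test_member, move 0 3, Push 7 (Bit True),
     If 6 {None} Skip (seq [clear 6, emit_both t, clear 8, copy 7 8 4])]"

text \<open>\<open>M\<close> bounds the length of every numeral involved. The term
  \<open>130 * M\<close> rounds up \<open>34 * 3 * M\<close> for the two edges, \<open>2 * M\<close>
  for clearing and \<open>17 * M\<close> for copying.\<close>

lemma runs_scan_set:
  assumes "\<sigma> 0 = code_list code_nat S @ v" and "\<sigma> 2 = bits_of a"
    and "\<sigma> 4 = []" "\<sigma> 5 = []" "\<sigma> 6 = []" "\<sigma> 7 = bits_of (vertex j)" "\<sigma> 8 = bits_of (vertex p)"
    and "length (bits_of a) \<le> M" "p \<le> M" "j < M"
  shows "runs (scan_set t) \<sigma> (32 * length (code_list code_nat S) + 130 * M + 2 * t + 70)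
    (\<sigma>(0 := v, 3 := rev (code_list code_nat S) @ \<sigma> 3, 7 := bits_of (vertex (Suc j)),
      8 := bits_of (vertex (if a \<in> set S then Suc j else p)),
      9 := rev (concat (map code_edge (if a \<in> set S then
        [(vertex p, vertex (Suc j), time_of t a), (vertex (Suc j), vertex p, time_of t a)] else []))) @ \<sigma> 9))"
proof -
  let ?w = "concat (map code_nat S)"
  define \<rho>1 where "\<rho>1 = \<sigma>(0 := ?w @ RBr # v, 3 := LBr # \<sigma> 3)"
  define \<rho>2 where "\<rho>2 = \<sigma>(0 := v, 3 := rev (code_list code_nat S) @ \<sigma> 3, 6 := flag (a \<in> set S),
    7 := bits_of (vertex (Suc j)))"
  have 1: "runs (move 0 3) \<sigma> 7 \<rho>1"
    unfolding \<rho>1_def by (rule runs_move) (simp_all add: assms code_list_def)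
  have 2: "runs test_member \<rho>1 (32 * length ?w + 1)
      (\<rho>1(0 := RBr # v, 3 := rev ?w @ \<rho>1 3, 6 := flag (False \<or> a \<in> set S)))"
    by (rule runs_test_member) (simp_all add: \<rho>1_def assms flag_def)
  have 3: "runs (If 6 {None} Skip (seq [clear 6, emit_both t, clear 8, copy 7 8 4])) \<rho>2
      (130 * M + 2 * t + 50)
      (\<rho>2(6 := [], 8 := bits_of (vertex (if a \<in> set S then Suc j else p)),
      9 := rev (concat (map code_edge (if a \<in> set S then
        [(vertex p, vertex (Suc j), time_of t a), (vertex (Suc j), vertex p, time_of t a)] else []))) @ \<rho>2 9))"
  proof (cases "a \<in> set S")
    case True
    let ?\<rho> = "\<rho>2(6 := [])"
    have e: "runs (emit_both t) ?\<rho> (34 * (length (?\<rho> 8) + length (?\<rho> 7) + length (?\<rho> 2)) + 2 * t + 31)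
      (?\<rho>(9 := rev (concat (map code_edge [(vertex p, vertex (Suc j), time_of t a),
        (vertex (Suc j), vertex p, time_of t a)])) @ ?\<rho> 9))"
      by (rule runs_emit_both) (auto simp: \<rho>2_def assms)
    show ?thesis
      by (rule runs_weaken, rule runs_If_False, simp add: \<rho>2_def True flag_def,
          rule runs_seq_Cons[OF runs_clear], rule runs_seq_Cons[OF e],
          (rule runs_basic runs_clear runs_copy | (simp add: \<rho>2_def assms; fail))+)
        (use assms True in \<open>auto simp: \<rho>2_def fun_eq_iff bits_of_vertex flag_def replicate_append_same\<close>)
  next
    case False
    show ?thesis
      by (rule runs_weaken, rule runs_If_True, simp add: \<rho>2_def False flag_def, rule runs_Skip)
        (auto simp: \<rho>2_def False flag_def assms fun_eq_iff)
  qed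
  have 4: "runs (seq [move 0 3, Push 7 (Bit True),
     If 6 {None} Skip (seq [clear 6, emit_both t, clear 8, copy 7 8 4])])
     (\<rho>1(0 := RBr # v, 3 := rev ?w @ \<rho>1 3, 6 := flag (False \<or> a \<in> set S)))
     (7 + (1 + ((130 * M + 2 * t + 50) + 1)))
      (\<rho>2(6 := [], 8 := bits_of (vertex (if a \<in> set S then Suc j else p)),
      9 := rev (concat (map code_edge (if a \<in> set S then
        [(vertex p, vertex (Suc j), time_of t a), (vertex (Suc j), vertex p, time_of t a)] else []))) @ \<rho>2 9))"
    by (rule runs_seq_Cons, rule runs_move[where a = RBr and w = v], simp, simp,
        rule runs_seq_Cons[OF _ runs_seq_Cons[OF 3 runs_seq_Nil]], rule runs_weaken, rule runs_Push)
      (auto simp: \<rho>1_def \<rho>2_def fun_eq_iff code_list_def assms bits_of_vertex)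
  show ?thesis
    unfolding scan_set_def
    by (rule runs_weaken, rule runs_seq_Cons[OF 1 runs_seq_Cons[OF 2 4]])
      (auto simp: \<rho>2_def fun_eq_iff code_list_def assms)
qed

text \<open>Positions start at \<open>Suc j\<close>, hence at 1 for \<open>j = 0\<close>, because
  \<open>vertex 0\<close> is the terminal \<open>s\<close>.\<close>

fun hits :: "nat \<Rightarrow> nat \<Rightarrow> nat list list \<Rightarrow> nat list" where
  "hits a j [] = []"
| "hits a j (S # Ss) = (if a \<in> set S then Suc j # hits a (Suc j) Ss else hits a (Suc j) Ss)"

fun links :: "nat \<Rightarrow> nat list \<Rightarrow> nat tedge list" where
  "links l (x # y # xs) = (x, y, l) # (y, x, l) # links l (y # xs)"
| "links l _ = []"

text \<open>The recursion of \<open>links\<close> works from the front, but the program learns the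
  last hit only after the scan and then appends the edge to \<open>z\<close>.\<close>

lemma links_snoc: "xs \<noteq> [] \<Longrightarrow> links l (xs @ [y]) = links l xs @ [(last xs, y, l), (y, last xs, l)]"
  by (induction l xs rule: links.induct) auto

definition route :: "nat list list \<Rightarrow> nat \<Rightarrow> nat list" where
  "route fs a = 0 # map vertex (hits a 0 fs) @ [2]"

abbreviation code_family :: "nat list list \<Rightarrow> sym list" where
  "code_family Ss \<equiv> concat (map (code_list code_nat) Ss)"

definition scan_family :: "nat \<Rightarrow> prog" where
  "scan_family t = While 0 {Some LBr} (scan_set t)"

text \<open>The generalisation that makes the induction work: \<open>p\<close> is the last hit so
  far, and the edges still to be written are those of the path that continues from it. The route
  from \<open>s\<close> is the case \<open>j = 0\<close>, \<open>p = 0\<close>.\<close>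

lemma runs_scan_family:
  assumes "\<sigma> 0 = code_family Ss @ [RBr]" and "\<sigma> 2 = bits_of a"
    and "\<sigma> 4 = []" "\<sigma> 5 = []" "\<sigma> 6 = []" "\<sigma> 7 = bits_of (vertex j)" "\<sigma> 8 = bits_of (vertex p)"
    and "length (bits_of a) \<le> M" "p \<le> M" "j + length Ss \<le> M"
  shows "runs (scan_family t) \<sigma>
    (32 * length (code_family Ss) + length Ss * (130 * M + 2 * t + 71) + 1)
    (\<sigma>(0 := [RBr], 3 := rev (code_family Ss) @ \<sigma> 3, 7 := bits_of (vertex (j + length Ss)),
      8 := bits_of (vertex (last (p # hits a j Ss))),
      9 := rev (concat (map code_edge (links (time_of t a) (map vertex (p # hits a j Ss))))) @ \<sigma> 9))"
  using assms
proof (induction Ss arbitrary: \<sigma> j p)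
  case Nil
  have "runs (scan_family t) \<sigma> 1 \<sigma>"
    unfolding scan_family_def by (rule runs_While_False) (use Nil in simp)
  then show ?case by (rule runs_weaken) (use Nil in \<open>auto simp: fun_eq_iff\<close>)
next
  case (Cons S Ss)
  let ?p = "if a \<in> set S then Suc j else p"
  define \<rho> where "\<rho> = \<sigma>(0 := code_family Ss @ [RBr], 3 := rev (code_list code_nat S) @ \<sigma> 3,
      7 := bits_of (vertex (Suc j)), 8 := bits_of (vertex ?p),
      9 := rev (concat (map code_edge (if a \<in> set S then
        [(vertex p, vertex (Suc j), time_of t a), (vertex (Suc j), vertex p, time_of t a)] else []))) @ \<sigma> 9)"
  have 1: "runs (scan_set t) \<sigma> (32 * length (code_list code_nat S) + 130 * M + 2 * t + 70) \<rho>"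
    unfolding \<rho>_def by (rule runs_scan_set) (use Cons.prems in simp_all)
  have 2: "runs (scan_family t) \<rho>
    (32 * length (code_family Ss) + length Ss * (130 * M + 2 * t + 71) + 1)
    (\<rho>(0 := [RBr], 3 := rev (code_family Ss) @ \<rho> 3, 7 := bits_of (vertex (Suc j + length Ss)),
      8 := bits_of (vertex (last (?p # hits a (Suc j) Ss))),
      9 := rev (concat (map code_edge (links (time_of t a) (map vertex (?p # hits a (Suc j) Ss))))) @ \<rho> 9))"
    by (rule Cons.IH) (use Cons.prems in \<open>auto simp: \<rho>_def\<close>)
  show ?case
    unfolding scan_family_def
    by (rule runs_weaken, rule runs_While_True[OF _ 1 2[unfolded scan_family_def]])
      (use Cons.prems in \<open>auto simp: \<rho>_def fun_eq_iff code_list_def[of _ S]\<close>)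
qed

text \<open>The universe lies reversed on stack \<open>1\<close>, so moving a numeral to stack
  \<open>2\<close> puts its digits in order. After the scan, stack \<open>7\<close> is reused for
  the digits of \<open>z\<close>, and the family returns to stack \<open>0\<close> for the next
  element.\<close>

definition scan_element :: "nat \<Rightarrow> prog" where
  "scan_element t = seq [Pop 1, moves 1 digits 2, scan_family t,
     clear 7, pushes 7 [Bit True, Bit False], emit_both t,
     clear 7, clear 8, clear 2, move_all 3 0]"

lemma last_hits_le: "p \<le> j + length Ss \<Longrightarrow> last (p # hits a j Ss) \<le> j + length Ss"
proof (induction Ss arbitrary: p j)
  case (Cons S Ss)
  then show ?case
    using Cons.IH[of "Suc j" "Suc j"] Cons.IH[of p "Suc j"] by (simp split: if_splits)
qed simp

lemma runs_scan_element:
  assumes "\<sigma> 1 = rev (code_nat a) @ w" "top_of w \<notin> digits" "\<sigma> 0 = code_family fs @ [RBr]"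
    and "\<And>k. k \<in> {2..8} \<Longrightarrow> \<sigma> k = []"
    and "length (bits_of a) \<le> M" "length fs \<le> M"
  shows "runs (scan_element t) \<sigma>
    (40 * length (code_family fs) + M * (130 * M + 2 * t + 71) + 90 * M + 2 * t + 130)
    (\<sigma>(1 := w, 9 := rev (concat (map code_edge (links (time_of t a) (route fs a)))) @ \<sigma> 9))"
proof -
  have empty: "\<sigma> 2 = []" "\<sigma> 3 = []" "\<sigma> 4 = []" "\<sigma> 5 = []" "\<sigma> 6 = []" "\<sigma> 7 = []" "\<sigma> 8 = []"
    by (rule assms(4); simp)+
  let ?q = "last (0 # hits a 0 fs)" and ?L = "\<lambda>xs. concat (map code_edge (links (time_of t a) xs))"
  define \<rho>1 where "\<rho>1 = \<sigma>(1 := w, 2 := bits_of a)"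
  define \<rho>2 where "\<rho>2 = \<rho>1(0 := [RBr], 3 := rev (code_family fs), 7 := bits_of (vertex (length fs)),
    8 := bits_of (vertex ?q), 9 := rev (?L (map vertex (0 # hits a 0 fs))) @ \<sigma> 9)"
  \<comment> \<open>Names for the two products hide the nonlinear terms, so that
    \<open>X \<le> Y\<close> is enough for linear arithmetic.\<close>
  define X where "X = length fs * (130 * M + 2 * t + 71)"
  define Y where "Y = M * (130 * M + 2 * t + 71)"
  define \<rho>3 where "\<rho>3 = \<rho>2(7 := [Bit False, Bit True])"
  have 1: "runs (moves 1 digits 2) (\<sigma>(1 := rev (bits_of a) @ w)) (8 * length (bits_of a) + 1) \<rho>1"
    by (rule runs_weaken, rule runs_moves[where w = "rev (bits_of a)" and v = w])
      (use assms bits_of_in_digits in \<open>auto simp: empty \<rho>1_def fun_eq_iff\<close>)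
  have 2: "runs (scan_family t) \<rho>1
     (32 * length (code_family fs) + X + 1) \<rho>2"
    unfolding X_def
    by (rule runs_weaken, rule runs_scan_family[where j = 0 and p = 0 and Ss = fs and a = a and M = M])
      (use assms in \<open>auto simp: empty \<rho>1_def \<rho>2_def fun_eq_iff vertex_def\<close>)
  have 3: "runs (pushes 7 [Bit True, Bit False]) (\<rho>2(7 := [])) 3 \<rho>3"
    by (rule runs_weaken, rule runs_pushes) (auto simp: \<rho>3_def)
  have 4: "runs (emit_both t) \<rho>3 (34 * (length (\<rho>3 8) + length (\<rho>3 7) + length (\<rho>3 2)) + 2 * t + 31)
    (\<rho>3(9 := rev (concat (map code_edge [(vertex ?q, 2, time_of t a), (2, vertex ?q, time_of t a)])) @ \<rho>3 9))"
    by (rule runs_emit_both) (auto simp: \<rho>1_def \<rho>2_def \<rho>3_def bits_of_2 empty)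
  have q: "?q \<le> M" using last_hits_le[of 0 0 fs a] assms(6) by simp
  have fs: "X \<le> Y"
    unfolding X_def Y_def using assms(6) by (rule mult_right_mono) simp
  have 0: "runs (Pop 1) \<sigma> 1 (\<sigma>(1 := rev (bits_of a) @ w))"
    by (rule runs_weaken, rule runs_Pop) (use assms in \<open>auto simp: code_nat_def\<close>)
  have "?L (route fs a) = ?L (map vertex (0 # hits a 0 fs)) @
    concat (map code_edge [(vertex ?q, 2, time_of t a), (2, vertex ?q, time_of t a)])"
    using links_snoc[of "map vertex (0 # hits a 0 fs)" "time_of t a" 2]
    by (simp add: route_def last_map vertex_def)
  then have L: "rev (?L (route fs a)) @ \<sigma> 9 =
    rev (concat (map code_edge [(vertex ?q, 2, time_of t a), (2, vertex ?q, time_of t a)])) @ \<rho>3 9"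
    by (simp add: \<rho>2_def \<rho>3_def)
  show ?thesis
    unfolding scan_element_def L Y_def[symmetric]
    by (rule runs_weaken, rule runs_seq_Cons[OF 0 runs_seq_Cons[OF 1 runs_seq_Cons[OF 2
          runs_seq_Cons[OF runs_clear runs_seq_Cons[OF 3 runs_seq_Cons[OF 4]]]]]],
        (rule runs_basic runs_clear runs_move_all | (simp; fail))+)
      (use q fs assms in \<open>auto simp: \<rho>1_def \<rho>2_def \<rho>3_def fun_eq_iff empty bits_of_vertex\<close>)
qed

lemma code_nats_top: "top_of (rev (concat (map code_nat us)) @ []) \<notin> digits"
  by (cases us rule: rev_cases) (auto simp: code_nat_def)

text \<open>In the reversed universe each numeral begins with its separator, even that of
  \<open>0\<close>, which has no digits. Hence \<open>Sep\<close> on top is a reliable sign of a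
  further element.\<close>

definition scan_universe :: "nat \<Rightarrow> prog" where
  "scan_universe t = While 1 {Some Sep} (scan_element t)"

lemma runs_scan_universe:
  assumes "\<sigma> 1 = rev (concat (map code_nat us))" "\<sigma> 0 = code_family fs @ [RBr]"
    and "\<And>k. k \<in> {2..8} \<Longrightarrow> \<sigma> k = []"
    and "length (concat (map code_nat us)) \<le> M" "length fs \<le> M"
  shows "runs (scan_universe t) \<sigma> (length us *
      (40 * length (code_family fs) + M * (130 * M + 2 * t + 71) + 90 * M + 2 * t + 131) + 1)
    (\<sigma>(1 := [], 9 := rev (concat (map code_edge
      (concat (map (\<lambda>a. links (time_of t a) (route fs a)) (rev us))))) @ \<sigma> 9))"
  using assms
proof (induction us arbitrary: \<sigma> rule: rev_induct)
  case Nil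
  have "runs (scan_universe t) \<sigma> 1 \<sigma>"
    unfolding scan_universe_def by (rule runs_While_False) (use Nil in simp)
  then show ?case by (rule runs_weaken) (use Nil in \<open>auto simp: fun_eq_iff\<close>)
next
  case (snoc a us)
  let ?C = "40 * length (code_family fs) + M * (130 * M + 2 * t + 71) + 90 * M + 2 * t + 130"
  let ?L = "\<lambda>us. concat (map (\<lambda>a. links (time_of t a) (route fs a)) us)"
  define \<rho> where "\<rho> = \<sigma>(1 := rev (concat (map code_nat us)),
    9 := rev (concat (map code_edge (links (time_of t a) (route fs a)))) @ \<sigma> 9)"
  have 1: "runs (scan_element t) \<sigma> ?C \<rho>"
    unfolding \<rho>_def
    by (rule runs_scan_element) (use snoc.prems code_nats_top in \<open>auto simp: code_nat_def[of a]\<close>)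
  have 2: "runs (scan_universe t) \<rho> (length us * (?C + 1) + 1)
    (\<rho>(1 := [], 9 := rev (concat (map code_edge (?L (rev us)))) @ \<rho> 9))"
    unfolding add.assoc one_add_one
    by (rule runs_weaken, rule snoc.IH) (use snoc.prems in \<open>auto simp: \<rho>_def\<close>)
  show ?case
    unfolding scan_universe_def
    by (rule runs_weaken, rule runs_While_True[OF _ 1 2[unfolded scan_universe_def]])
      (use snoc.prems in \<open>auto simp: \<rho>_def fun_eq_iff code_nat_def[of a]\<close>)
qed

section \<open>Listing the vertices\<close>

definition list_vertices :: prog where
  "list_vertices = While 0 {Some LBr} (seq [moves 0 (- {None, Some RBr}) 3, move 0 3,
     Push 7 (Bit True), copy 7 10 4, Push 10 Sep])"

lemma runs_list_vertices:
  assumes "\<sigma> 0 = code_family Ss @ [RBr]" "\<sigma> 4 = []" "\<sigma> 7 = bits_of (vertex j)" "j + length Ss \<le> M"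
  shows "runs list_vertices \<sigma> (8 * length (code_family Ss) + length Ss * (17 * M + 15) + 1)
    (\<sigma>(0 := [RBr], 3 := rev (code_family Ss) @ \<sigma> 3, 7 := bits_of (vertex (j + length Ss)),
      10 := rev (concat (map (\<lambda>i. code_nat (vertex i)) [Suc j..<Suc (j + length Ss)])) @ \<sigma> 10))"
  using assms
proof (induction Ss arbitrary: \<sigma> j)
  case Nil
  have "runs list_vertices \<sigma> 1 \<sigma>"
    unfolding list_vertices_def by (rule runs_While_False) (use Nil in simp)
  then show ?case by (rule runs_weaken) (use Nil in \<open>auto simp: fun_eq_iff\<close>)
next
  case (Cons S Ss)
  let ?w = "LBr # concat (map code_nat S)"
  let ?p = "seq [moves 0 (- {None, Some RBr}) 3, move 0 3, Push 7 (Bit True), copy 7 10 4, Push 10 Sep]"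
  define \<rho> where "\<rho> = \<sigma>(0 := code_family Ss @ [RBr], 3 := rev (code_list code_nat S) @ \<sigma> 3,
      7 := bits_of (vertex (Suc j)), 10 := rev (code_nat (vertex (Suc j))) @ \<sigma> 10)"
  have 0: "runs (moves 0 (- {None, Some RBr}) 3) \<sigma> (8 * length ?w + 1)
      (\<sigma>(0 := RBr # code_family Ss @ [RBr], 3 := rev ?w @ \<sigma> 3))"
    by (rule runs_moves) (use Cons.prems code_nats_symbols[of S] in \<open>auto simp: code_list_def[of _ S]\<close>)
  have 1: "runs ?p \<sigma> (8 * length (code_list code_nat S) + 17 * M + 14) \<rho>"
    by (rule runs_weaken, rule runs_seq_Cons[OF 0],
        (rule runs_basic runs_move_hd runs_copy | (use Cons.prems in \<open>simp; fail\<close>))+)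
      (use Cons.prems in \<open>auto simp: \<rho>_def fun_eq_iff code_list_def[of _ S] code_nat_def bits_of_vertex
        replicate_append_same\<close>)
  have 2: "runs list_vertices \<rho> (8 * length (code_family Ss) + length Ss * (17 * M + 15) + 1)
    (\<rho>(0 := [RBr], 3 := rev (code_family Ss) @ \<rho> 3, 7 := bits_of (vertex (Suc j + length Ss)),
      10 := rev (concat (map (\<lambda>i. code_nat (vertex i)) [Suc (Suc j)..<Suc (Suc j + length Ss)])) @ \<rho> 10))"
    by (rule Cons.IH) (use Cons.prems in \<open>auto simp: \<rho>_def\<close>)
  have "[Suc j..<Suc (j + length (S # Ss))] = Suc j # [Suc (Suc j)..<Suc (Suc j + length Ss)]"
    by (subst upt_conv_Cons) auto
  then show ?case
    unfolding list_vertices_def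
    by (intro runs_weaken[OF runs_While_True[OF _ 1 2[unfolded list_vertices_def]]])
      (use Cons.prems in \<open>auto simp: \<rho>_def fun_eq_iff code_list_def[of _ S] simp del: upt_Suc\<close>)
qed

section \<open>Output length and polynomial bounds\<close>

lemma exec_length_le: "exec p \<sigma> n \<sigma>' \<Longrightarrow> length (\<sigma>' k) \<le> length (\<sigma> k) + n"
  by (induction rule: exec.induct) (auto intro: le_trans)

text \<open>Since a step lengthens a stack by at most one symbol, a time bound is also a bound on
  the output. This spares a separate estimate of the code of all edges.\<close>

lemma runs_length_le: "runs p \<sigma> n \<sigma>' \<Longrightarrow> length (\<sigma>' k) \<le> length (\<sigma> k) + n"
  unfolding runs_def using exec_length_le[of p \<sigma> _ \<sigma>' k] by (meson add_left_mono le_trans)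

lemma poly_time_onI:
  assumes "\<And>x. x \<in> X \<Longrightarrow>
    \<exists>\<sigma>. runs p (load (inp x)) (poly q (sum_list (map length (inp x)))) \<sigma> \<and> \<sigma> 0 = out x"
  shows "poly_time_on X inp out"
  unfolding poly_time_on_def using assms unfolding runs_def by meson

lemma load_simps [simp]: "load [w] 0 = w" "k > 0 \<Longrightarrow> load [w] k = []"
  "load [w, w'] 0 = w" "load [w, w'] (Suc 0) = w'" "k > 1 \<Longrightarrow> load [w, w'] k = []"
  by (auto simp: load_def)

lemma length_le_concat: "(\<And>x. c x \<noteq> []) \<Longrightarrow> length xs \<le> length (concat (map c xs))"
proof (induction xs)
  case (Cons x xs)
  have "length xs \<le> length (concat (map c xs))" using Cons by blast
  then show ?case using Cons.prems[of x] by (cases "c x") auto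
qed simp

lemma code_nat_vertex: "code_nat (vertex p) = replicate p (Bit True) @ [Sep]"
  by (simp add: code_nat_def bits_of_vertex)

text \<open>The order \<open>rev us\<close> is that in which the program meets the elements. The
  lifetime only has to be at least every label; a block of ones that is long enough does this
  without computing a maximum.\<close>

definition reduce :: "nat \<Rightarrow> nat list \<times> nat list list \<Rightarrow> ts_instance" where
  "reduce t = (\<lambda>(us, fs). (0 # 2 # map vertex [1..<Suc (length fs)],
     concat (map (\<lambda>a. links (time_of t a) (route fs a)) (rev us)),
     vertex (length (concat (map code_nat us)) + Suc t), 0, 2))"

text \<open>The constant map in \<open>moves2\<close> produces the ones of the lifetime while the
  universe is being reversed. The symbols pushed on stack \<open>10\<close> are the codes of
  \<open>s\<close> and \<open>z\<close>.\<close>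

definition generate :: "nat \<Rightarrow> prog" where
  "generate t = seq [Pop 0, moves2 0 (insert (Some Sep) digits) 1 11 (\<lambda>_. Bit True),
     pushes 11 (replicate (Suc t) (Bit True)), Pop 0, Pop 0,
     pushes 10 [Sep, Bit False, Bit True, Sep], list_vertices, move_all 3 0, clear 7,
     scan_universe t, clear 0]"

text \<open>Stack \<open>0\<close> is filled from the end of the output, so \<open>z\<close>,
  \<open>s\<close> and the separator of the lifetime come first. Moving stacks \<open>9\<close> and
  \<open>10\<close> undoes their reversal.\<close>

definition assemble :: prog where
  "assemble = seq [pushes 0 [Sep, Bit True, Bit False, Sep, Sep], move_all 11 0,
     Push 0 RBr, move_all 9 0, pushes 0 [LBr, RBr], move_all 10 0, Push 0 LBr]"

text \<open>Cubic, because for each element every set is scanned, with numerals of length at most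
  \<open>N\<close>. The 4 in the hypothesis counts the outer brackets of the two lists;
  \<open>t + 2\<close> in the base absorbs the terms in \<open>t\<close> and the constants.\<close>

lemma generate_time:
  fixes N t u f U F :: nat
  assumes "u \<le> U" "f \<le> F" "U + F + 4 = N"
  shows "9 * U + 18 * F + 2 * f + t + 30 + f * (17 * N + 15) +
      u * (40 * F + N * (130 * N + 2 * t + 71) + 90 * N + 2 * t + 131)
    \<le> 200 * (N + t + 2) ^ 3"
proof -
  have "f * (17 * N + 15) \<le> N * (17 * N + 15)"
    using assms by (intro mult_right_mono) auto
  moreover have "u * (40 * F + N * (130 * N + 2 * t + 71) + 90 * N + 2 * t + 131)
      \<le> N * (40 * N + N * (130 * N + 2 * t + 71) + 90 * N + 2 * t + 131)"
    using assms by (intro mult_mono) auto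
  moreover have "N * (40 * N + N * (130 * N + 2 * t + 71) + 90 * N + 2 * t + 131) + N * (17 * N + 15)
      + 27 * N + t + 30 \<le> 200 * (N + t + 2) ^ 3"
    by (simp add: power3_eq_cube algebra_simps)
  ultimately show ?thesis using assms by linarith
qed

lemma runs_generate:
  fixes us :: "nat list" and fs :: "nat list list" and \<sigma> :: store
  defines "N \<equiv> length (\<sigma> 0)"
  assumes "\<sigma> 0 = code_prod (code_list code_nat) (code_list (code_list code_nat)) (us, fs)"
    and "\<And>k. k > 0 \<Longrightarrow> \<sigma> k = []"
  shows "runs (generate t) \<sigma> (200 * (N + t + 2) ^ 3)
    (\<sigma>(0 := [], 9 := rev (concat (map code_edge (fst (snd (reduce t (us, fs)))))),
      10 := rev (concat (map code_nat (fst (reduce t (us, fs))))),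
      11 := replicate (length (concat (map code_nat us)) + Suc t) (Bit True)))"
proof -
  let ?U = "concat (map code_nat us)" and ?F = "code_family fs"
  let ?vs = "concat (map (\<lambda>i. code_nat (vertex i)) [1..<Suc (length fs)])"
  have \<sigma>: "\<sigma> 0 = LBr # ?U @ RBr # LBr # ?F @ [RBr]"
    using assms(2) by (simp add: code_prod_def code_list_def)
  define \<rho>1 where "\<rho>1 = \<sigma>(0 := RBr # LBr # ?F @ [RBr], 1 := rev ?U,
    11 := replicate (length ?U) (Bit True))"
  define \<rho>2 where "\<rho>2 = \<rho>1(0 := ?F @ [RBr], 11 := replicate (length ?U + Suc t) (Bit True),
    10 := [Sep, Bit True, Bit False, Sep])"
  define \<rho>3 where "\<rho>3 = \<rho>2(0 := [RBr], 3 := rev ?F, 7 := bits_of (vertex (length fs)),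
    10 := rev ?vs @ \<rho>2 10)"
  define \<rho>4 where "\<rho>4 = \<rho>3(0 := ?F @ [RBr], 3 := [], 7 := [])"
  have 0: "runs (Pop 0) \<sigma> 1 (\<sigma>(0 := ?U @ RBr # LBr # ?F @ [RBr]))"
    by (rule runs_weaken, rule runs_Pop) (simp_all add: \<sigma>)
  have 1: "runs (moves2 0 (insert (Some Sep) digits) 1 11 (\<lambda>_. Bit True))
    (\<sigma>(0 := ?U @ RBr # LBr # ?F @ [RBr])) (9 * length ?U + 1) \<rho>1"
    by (rule runs_weaken, rule runs_moves2[where w = ?U and v = "RBr # LBr # ?F @ [RBr]"])
      (use code_nats_symbols[of us] assms(3)
       in \<open>auto simp: \<rho>1_def fun_eq_iff map_replicate_const rev_concat\<close>)
  have 2: "runs list_vertices \<rho>2 (8 * length ?F + length fs * (17 * N + 15) + 1) \<rho>3"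
    by (rule runs_weaken, rule runs_list_vertices[where Ss = fs and j = 0 and M = N])
      (use length_le_concat[of "code_list code_nat" fs] assms(3)
       in \<open>auto simp: \<rho>1_def \<rho>2_def \<rho>3_def vertex_def N_def \<sigma> code_list_def fun_eq_iff\<close>)
  have 3: "runs (scan_universe t) \<rho>4 (length us *
      (40 * length ?F + N * (130 * N + 2 * t + 71) + 90 * N + 2 * t + 131) + 1)
    (\<rho>4(1 := [], 9 := rev (concat (map code_edge
      (concat (map (\<lambda>a. links (time_of t a) (route fs a)) (rev us))))) @ \<rho>4 9))"
    by (rule runs_scan_universe)
      (use length_le_concat[of "code_list code_nat" fs] assms(3)
       in \<open>auto simp: \<rho>1_def \<rho>2_def \<rho>3_def \<rho>4_def N_def \<sigma> code_list_def\<close>)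
  have len: "length us \<le> length ?U" "length fs \<le> length ?F" "length ?U + length ?F + 4 = N"
    using length_le_concat[of code_nat us] length_le_concat[of "code_list code_nat" fs]
    by (auto simp: N_def \<sigma> code_nat_def code_list_def)
  have a: "runs (move_all 3 0) \<rho>3 (8 * length ?F + 1) (\<rho>3(3 := [], 0 := ?F @ [RBr]))"
    by (rule runs_weaken, rule runs_move_all) (simp_all add: \<rho>3_def)
  have b: "runs (clear 7) (\<rho>3(3 := [], 0 := ?F @ [RBr])) (2 * length fs + 1) \<rho>4"
    by (rule runs_weaken, rule runs_clear) (auto simp: \<rho>3_def \<rho>4_def fun_eq_iff bits_of_vertex)
  have c: "runs (seq [pushes 11 (replicate (Suc t) (Bit True)), Pop 0, Pop 0,
     pushes 10 [Sep, Bit False, Bit True, Sep], list_vertices, move_all 3 0, clear 7,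
     scan_universe t, clear 0]) \<rho>1 (t + 3 + (1 + (1 + (5 +
      (8 * length ?F + length fs * (17 * N + 15) + 1 + (8 * length ?F + 1 + (2 * length fs + 1 +
      (length us * (40 * length ?F + N * (130 * N + 2 * t + 71) + 90 * N + 2 * t + 131) + 1 +
      (2 * length ?F + 3 + 1)))))))))
    (\<rho>4(0 := [], 1 := [], 9 := rev (concat (map code_edge (fst (snd (reduce t (us, fs))))))))"
    (is "runs _ _ (t + 3 + (1 + (1 + (5 + ?n)))) _")
  proof -
    have d: "runs (seq [list_vertices, move_all 3 0, clear 7, scan_universe t, clear 0]) \<rho>2 ?n
      (\<rho>4(0 := [], 1 := [], 9 := rev (concat (map code_edge (fst (snd (reduce t (us, fs))))))))"
      by (rule runs_seq_Cons[OF 2 runs_seq_Cons[OF a runs_seq_Cons[OF b runs_seq_Cons[OF 3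
            runs_seq_Cons[OF runs_weaken[OF runs_clear] runs_seq_Nil]]]]])
        (use assms(3) in \<open>auto simp: \<rho>1_def \<rho>2_def \<rho>3_def \<rho>4_def fun_eq_iff reduce_def\<close>)
    show ?thesis
      by (rule runs_seq_Cons[OF runs_weaken[OF runs_pushes _ refl] runs_seq_Cons[OF runs_Pop
            runs_seq_Cons[OF runs_Pop runs_seq_Cons[OF runs_weaken[OF runs_pushes] d]]]])
        (use assms(3) in \<open>auto simp: \<rho>1_def \<rho>2_def fun_eq_iff replicate_add[symmetric] add_ac
          simp del: replicate_Suc replicate_add\<close>)
  qed
  show ?thesis
    unfolding generate_def
    by (rule runs_weaken, rule runs_seq_Cons[OF 0 runs_seq_Cons[OF 1 c]])
      (use generate_time[OF len, of t] assms(3)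
       in \<open>auto simp: \<rho>1_def \<rho>2_def \<rho>3_def \<rho>4_def fun_eq_iff reduce_def code_nat_def[of 0]
         code_nat_def[of 2] bits_of_2 comp_def simp del: upt_Suc\<close>)
qed

lemma runs_assemble:
  assumes "\<sigma> 0 = []" "\<sigma> 9 = rev (concat (map code_edge (fst (snd (reduce t (us, fs))))))"
    "\<sigma> 10 = rev (concat (map code_nat (fst (reduce t (us, fs)))))"
    "\<sigma> 11 = replicate (length (concat (map code_nat us)) + Suc t) (Bit True)"
  shows "runs assemble \<sigma> (8 * (length (\<sigma> 9) + length (\<sigma> 10) + length (\<sigma> 11)) + 20)
    (\<sigma>(0 := inst_code (temporal_separator_problem t) (reduce t (us, fs)), 9 := [], 10 := [], 11 := []))"
  unfolding assemble_def
  by (rule runs_weaken, (rule runs_basic runs_pushes runs_move_all | (simp; fail))+)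
    (auto simp: assms fun_eq_iff temporal_separator_problem_def reduce_def code_prod_def
      code_list_def code_edge_def code_nat_def[of 0] code_nat_def[of 2] bits_of_2 bits_of_vertex
      code_nat_vertex simp del: replicate_Suc)

lemma poly_time_reduce:
  "poly_time_on X (\<lambda>x. [inst_code set_cover_problem x])
     (\<lambda>x. inst_code (temporal_separator_problem t) (reduce t x))"
\<comment> \<open>With \<open>k\<close> the cube, \<open>generate\<close> takes at most
  \<open>200 * k\<close> steps and so leaves at most \<open>600 * k\<close> symbols on the three
  output stacks; moving them costs 8 each, plus 20, and
  \<open>200 + 8 * 600 + 20 = 5020\<close>.\<close>
proof (rule poly_time_onI[where p = "Seq (generate t) assemble" and q = "[:5020:] * [:t + 2, 1:] ^ 3"])
  fix x :: "nat list \<times> nat list list"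
  obtain us fs where x: "x = (us, fs)" by force
  let ?w = "inst_code set_cover_problem x"
  let ?n = "200 * (length ?w + t + 2) ^ 3"
  define \<rho> where "\<rho> = (load [?w])(0 := [], 9 := rev (concat (map code_edge (fst (snd (reduce t (us, fs)))))),
      10 := rev (concat (map code_nat (fst (reduce t (us, fs))))),
      11 := replicate (length (concat (map code_nat us)) + Suc t) (Bit True))"
  have 1: "runs (generate t) (load [?w]) ?n \<rho>"
    unfolding \<rho>_def
    by (rule runs_weaken, rule runs_generate) (simp_all add: x set_cover_problem_def)
  have "length (\<rho> k) \<le> ?n" if "k \<in> {9, 10, 11}" for k
    using runs_length_le[OF 1, of k] that by auto
  from this[of 9] this[of 10] this[of 11]
  have len: "length (\<rho> 9) + length (\<rho> 10) + length (\<rho> 11) \<le> 3 * ?n" by simp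
  have "200 * k + (8 * l + 20) \<le> 5020 * k" if "l \<le> 3 * (200 * k)" "1 \<le> k" for k l :: nat
    using that by linarith
  from this[OF len] have "?n + (8 * (length (\<rho> 9) + length (\<rho> 10) + length (\<rho> 11)) + 20)
      \<le> 5020 * (length ?w + t + 2) ^ 3"
    by simp
  then show "\<exists>\<sigma>. runs (Seq (generate t) assemble) (load [?w])
      (poly ([:5020:] * [:t + 2, 1:] ^ 3) (sum_list (map length [?w]))) \<sigma> \<and>
      \<sigma> 0 = inst_code (temporal_separator_problem t) (reduce t x)"
    by (intro exI conjI, rule_tac runs_weaken[OF runs_Seq[OF 1 runs_assemble] _ refl])
      (auto simp: \<rho>_def x poly_mult poly_power add_ac)
qed

section \<open>A program for the solution map\<close>

text \<open>
  A vertex is a block of \<open>j\<close> ones and is decoded by moving \<open>j - 1\<close> sets out of the way. Stacks: \<open>0\<close> the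
  family, \<open>1\<close> the solution, \<open>2\<close> the sets that were passed, \<open>3\<close> the output (reversed).
\<close>

definition skip_sets :: prog where
  "skip_sets = While 1 {Some (Bit True)} (seq [Pop 1, moves 0 (- {None, Some RBr}) 2, move 0 2])"

lemma runs_skip_sets:
  assumes "\<sigma> 1 = replicate (length Ss) (Bit True) @ Sep # v" and "\<sigma> 0 = code_family Ss @ u"
  shows "runs skip_sets \<sigma> (8 * length (code_family Ss) + 11 * length Ss + 1)
    (\<sigma>(0 := u, 1 := Sep # v, 2 := rev (code_family Ss) @ \<sigma> 2))"
  using assms
proof (induction Ss arbitrary: \<sigma>)
  case Nil
  have "runs skip_sets \<sigma> 1 \<sigma>"
    unfolding skip_sets_def by (rule runs_While_False) (use Nil in simp)
  then show ?case by (rule runs_weaken) (use Nil in \<open>auto simp: fun_eq_iff\<close>)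
next
  case (Cons S Ss)
  let ?w = "LBr # concat (map code_nat S)"
  let ?\<sigma> = "\<sigma>(1 := replicate (length Ss) (Bit True) @ Sep # v)"
  define \<rho> where "\<rho> = ?\<sigma>(0 := code_family Ss @ u, 2 := rev (code_list code_nat S) @ \<sigma> 2)"
  have 0: "runs (Pop 1) \<sigma> 1 ?\<sigma>"
    by (rule runs_weaken, rule runs_Pop) (use Cons.prems in simp_all)
  have 1: "runs (moves 0 (- {None, Some RBr}) 2) ?\<sigma> (8 * length ?w + 1)
      (?\<sigma>(0 := RBr # code_family Ss @ u, 2 := rev ?w @ ?\<sigma> 2))"
    by (rule runs_moves) (use Cons.prems code_nats_symbols[of S] in \<open>auto simp: code_list_def[of _ S]\<close>)
  have 2: "runs (seq [Pop 1, moves 0 (- {None, Some RBr}) 2, move 0 2]) \<sigma>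
      (8 * length (code_list code_nat S) + 10) \<rho>"
    by (rule runs_weaken, rule runs_seq_Cons[OF 0], rule runs_seq_Cons[OF 1],
        (rule runs_basic runs_move_hd | (simp; fail))+)
      (auto simp: \<rho>_def fun_eq_iff code_list_def[of _ S])
  have 3: "runs skip_sets \<rho> (8 * length (code_family Ss) + 11 * length Ss + 1)
    (\<rho>(0 := u, 1 := Sep # v, 2 := rev (code_family Ss) @ \<rho> 2))"
    by (rule Cons.IH) (simp_all add: \<rho>_def)
  show ?case
    unfolding skip_sets_def
    by (rule runs_weaken, rule runs_While_True[OF _ 2 3[unfolded skip_sets_def]])
      (use Cons.prems in \<open>auto simp: \<rho>_def fun_eq_iff\<close>)
qed

text \<open>The first \<open>Pop\<close> turns the position counted from 1 into the number of sets
  to skip. The closing bracket of the wanted set stays on stack \<open>0\<close>, so returning stack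
  \<open>2\<close> restores the family exactly.\<close>

definition fetch :: prog where
  "fetch = seq [Pop 1, skip_sets, Pop 1, moves2 0 (- {None, Some RBr}) 2 3 id, Push 3 RBr, move_all 2 0]"

lemma runs_fetch:
  assumes "\<sigma> 1 = code_nat (vertex (Suc j)) @ v" "\<sigma> 0 = code_family fs @ [RBr]" "\<sigma> 2 = []"
    and "j < length fs"
  shows "runs fetch \<sigma> (40 * length (code_family fs) + 10)
    (\<sigma>(1 := v, 3 := rev (code_list code_nat (fs ! j)) @ \<sigma> 3))"
proof -
  let ?A = "take j fs" and ?B = "drop (Suc j) fs" and ?w = "LBr # concat (map code_nat (fs ! j))"
  have fs: "fs = ?A @ fs ! j # ?B" using assms(4) by (rule id_take_nth_drop)
  have code: "code_family fs = code_family ?A @ code_list code_nat (fs ! j) @ code_family ?B"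
    by (subst fs) simp
  define \<rho>1 where "\<rho>1 = \<sigma>(1 := replicate j (Bit True) @ Sep # v)"
  define \<rho>2 where "\<rho>2 = \<rho>1(0 := code_list code_nat (fs ! j) @ code_family ?B @ [RBr],
    1 := v, 2 := rev (code_family ?A))"
  define \<rho>3 where "\<rho>3 = \<rho>2(0 := RBr # code_family ?B @ [RBr],
    2 := rev ?w @ rev (code_family ?A), 3 := rev ?w @ \<sigma> 3)"
  have 0: "runs (Pop 1) \<sigma> 1 \<rho>1"
    by (rule runs_weaken, rule runs_Pop)
      (use assms in \<open>simp_all add: \<rho>1_def code_nat_def bits_of_vertex\<close>)
  have 1: "runs (seq (skip_sets # Pop 1 # ps)) \<rho>1
      ((8 * length (code_family ?A) + 11 * length ?A + 1) + (1 + n)) \<tau>"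
    if "runs (seq ps) \<rho>2 n \<tau>" for ps n \<tau>
    by (rule runs_seq_Cons[OF runs_skip_sets runs_seq_Cons[OF runs_weaken[OF runs_Pop order_refl] that]])
      (use assms in \<open>auto simp: \<rho>1_def \<rho>2_def code min_def fun_eq_iff\<close>)
  have 2: "runs (moves2 0 (- {None, Some RBr}) 2 3 id) \<rho>2 (9 * length ?w + 1) \<rho>3"
    by (rule runs_weaken, rule runs_moves2[where w = ?w and v = "RBr # code_family ?B @ [RBr]"])
      (use code_nats_symbols[of "fs ! j"] in \<open>auto simp: \<rho>1_def \<rho>2_def \<rho>3_def code_list_def[of _ "fs ! j"] fun_eq_iff\<close>)
  have 3: "runs (seq [Pop 1, skip_sets, Pop 1, moves2 0 (- {None, Some RBr}) 2 3 id, Push 3 RBr, move_all 2 0]) \<sigma>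
    (1 + ((8 * length (code_family ?A) + 11 * length ?A + 1) + (1 + ((9 * length ?w + 1) + (1 +
      ((8 * length (?w @ code_family ?A) + 1) + 1))))))
    (\<sigma>(1 := v, 3 := rev (code_list code_nat (fs ! j)) @ \<sigma> 3))"
    by (rule runs_seq_Cons[OF 0], rule 1, rule runs_seq_Cons[OF 2],
        rule runs_seq_Cons[OF runs_Push runs_seq_Cons[OF runs_weaken[OF runs_move_all] runs_seq_Nil]])
      (use assms in \<open>auto simp: \<rho>1_def \<rho>2_def \<rho>3_def code code_list_def[of _ "fs ! j"] fun_eq_iff\<close>)
  have "length ?A \<le> length (code_family ?A)"
    by (rule length_le_concat) (simp add: code_list_def)
  moreover have "length (code_family fs) = length (code_family ?A) + length ?w + 1 + length (code_family ?B)"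
    by (simp add: code code_list_def[of _ "fs ! j"])
  ultimately show ?thesis
    unfolding fetch_def using assms(4) by (intro runs_weaken[OF 3]) auto
qed

text \<open>A separator avoids \<open>s\<close>, so each of its vertices has a code that starts with
  a one; the final bracket ends the loop.\<close>

definition fetch_all :: prog where
  "fetch_all = While 1 {Some (Bit True)} fetch"

lemma runs_fetch_all:
  assumes "\<sigma> 1 = concat (map code_nat (map (\<lambda>j. vertex (Suc j)) js)) @ [RBr]"
    and "\<sigma> 0 = code_family fs @ [RBr]" "\<sigma> 2 = []" and "\<forall>j\<in>set js. j < length fs"
  shows "runs fetch_all \<sigma> (length js * (40 * length (code_family fs) + 11) + 1)
    (\<sigma>(1 := [RBr], 3 := rev (code_family (map ((!) fs) js)) @ \<sigma> 3))"
  using assms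
proof (induction js arbitrary: \<sigma>)
  case Nil
  have "runs fetch_all \<sigma> 1 \<sigma>"
    unfolding fetch_all_def by (rule runs_While_False) (use Nil in simp)
  then show ?case by (rule runs_weaken) (use Nil in \<open>auto simp: fun_eq_iff\<close>)
next
  case (Cons j js)
  define \<rho> where "\<rho> = \<sigma>(1 := concat (map code_nat (map (\<lambda>j. vertex (Suc j)) js)) @ [RBr],
    3 := rev (code_list code_nat (fs ! j)) @ \<sigma> 3)"
  have 1: "runs fetch \<sigma> (40 * length (code_family fs) + 10) \<rho>"
    unfolding \<rho>_def by (rule runs_fetch) (use Cons.prems in simp_all)
  have 2: "runs fetch_all \<rho> (length js * (40 * length (code_family fs) + 11) + 1)
    (\<rho>(1 := [RBr], 3 := rev (code_family (map ((!) fs) js)) @ \<rho> 3))"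
    by (rule Cons.IH) (use Cons.prems in \<open>auto simp: \<rho>_def\<close>)
  show ?case
    unfolding fetch_all_def
    by (rule runs_weaken, rule runs_While_True[OF _ 1 2[unfolded fetch_all_def]])
      (use Cons.prems in \<open>auto simp: \<rho>_def fun_eq_iff code_nat_vertex\<close>)
qed

text \<open>The vertex of the \<open>j\<close>-th set has exactly \<open>j\<close> digits, so its
  position is a digit count; the subtraction passes to list indices from 0.\<close>

definition cover_of :: "nat list \<times> nat list list \<Rightarrow> nat list \<Rightarrow> nat list list" where
  "cover_of x ys = map (\<lambda>y. snd x ! (length (bits_of y) - 1)) ys"

definition decode :: prog where
  "decode = seq [Pop 0, moves 0 (insert (Some Sep) digits) 4, Pop 0, Pop 0, Pop 1, Push 3 LBr,
     fetch_all, Push 3 RBr, clear 0]"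

lemma runs_decode:
  assumes "\<sigma> 0 = code_prod (code_list code_nat) (code_list (code_list code_nat)) (us, fs)"
    and "\<sigma> 1 = code_list code_nat (map (\<lambda>j. vertex (Suc j)) js)" "\<sigma> 2 = []" "\<sigma> 3 = []"
    and "\<forall>j\<in>set js. j < length fs"
    and "length (\<sigma> 0) + length (\<sigma> 1) = N"
  shows "\<exists>\<sigma>'. runs decode \<sigma> (50 * (N + 1) ^ 2) \<sigma>' \<and> \<sigma>' 0 = [] \<and>
    \<sigma>' 3 = rev (code_list (code_list code_nat) (map ((!) fs) js))"
proof -
  let ?U = "concat (map code_nat us)" and ?F = "code_family fs"
  let ?V = "concat (map code_nat (map (\<lambda>j. vertex (Suc j)) js))"
  define \<rho>1 where "\<rho>1 = \<sigma>(0 := ?U @ RBr # LBr # ?F @ [RBr])"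
  define \<rho>2 where "\<rho>2 = \<rho>1(0 := RBr # LBr # ?F @ [RBr], 4 := rev ?U @ \<sigma> 4)"
  define \<rho>3 where "\<rho>3 = \<rho>2(0 := ?F @ [RBr], 1 := ?V @ [RBr], 3 := [LBr])"
  have \<sigma>: "\<sigma> 0 = LBr # ?U @ RBr # LBr # ?F @ [RBr]" "\<sigma> 1 = LBr # ?V @ [RBr]"
    using assms by (simp_all add: code_prod_def code_list_def)
  have 0: "runs (Pop 0) \<sigma> 1 \<rho>1"
    by (rule runs_weaken, rule runs_Pop) (simp_all add: \<rho>1_def \<sigma>)
  have 1: "runs (moves 0 (insert (Some Sep) digits) 4) \<rho>1 (8 * length ?U + 1) \<rho>2"
    by (rule runs_weaken, rule runs_moves[where w = ?U and v = "RBr # LBr # ?F @ [RBr]"])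
      (use code_nats_symbols[of us] in \<open>auto simp: \<rho>1_def \<rho>2_def\<close>)
  have 2: "runs (seq (Pop 0 # Pop 0 # Pop 1 # Push 3 LBr # ps)) \<rho>2 (1 + (1 + (1 + (1 + n)))) \<tau>"
    if "runs (seq ps) \<rho>3 n \<tau>" for ps n \<tau>
    by (rule runs_seq_Cons[OF runs_Pop runs_seq_Cons[OF runs_Pop runs_seq_Cons[OF runs_Pop
          runs_seq_Cons[OF runs_weaken[OF runs_Push order_refl] that]]]])
      (use \<sigma> assms(3-5) in \<open>auto simp: \<rho>1_def \<rho>2_def \<rho>3_def fun_eq_iff\<close>)
  have 3: "runs fetch_all \<rho>3 (length js * (40 * length ?F + 11) + 1)
    (\<rho>3(1 := [RBr], 3 := rev (code_family (map ((!) fs) js)) @ \<rho>3 3))"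
    by (rule runs_fetch_all) (use assms in \<open>auto simp: \<rho>1_def \<rho>2_def \<rho>3_def\<close>)
  have 4: "runs decode \<sigma> (1 + ((8 * length ?U + 1) + (1 + (1 + (1 + (1 +
      ((length js * (40 * length ?F + 11) + 1) + (1 + ((2 * length ?F + 3) + 1)))))))))
    (\<rho>3(0 := [], 1 := [RBr], 3 := rev (code_list (code_list code_nat) (map ((!) fs) js))))"
    unfolding decode_def
    by (rule runs_seq_Cons[OF 0 runs_seq_Cons[OF 1 2]],
        rule runs_seq_Cons[OF 3 runs_seq_Cons[OF runs_Push runs_seq_Cons[OF runs_weaken[OF runs_clear]
          runs_seq_Nil]]])
      (auto simp: \<rho>1_def \<rho>2_def \<rho>3_def fun_eq_iff code_list_def[of "code_list code_nat"])
  have "length js \<le> length ?V"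
    using length_le_concat[of code_nat "map (\<lambda>j. vertex (Suc j)) js"] by (simp add: code_nat_def)
  then have "length js * (40 * length ?F + 11) \<le> N * (40 * N + 11)"
    using assms(6) \<sigma> by (intro mult_mono) auto
  moreover have "N * (40 * N + 11) + 8 * N + 15 \<le> 50 * (N + 1) ^ 2"
    by (simp add: power2_eq_square algebra_simps)
  moreover have "8 * length ?U + 2 * length ?F \<le> 8 * N"
    using assms(6) \<sigma> by simp
  ultimately show ?thesis
    by (intro exI[of _ "\<rho>3(0 := [], 1 := [RBr],
        3 := rev (code_list (code_list code_nat) (map ((!) fs) js)))"] conjI runs_weaken[OF 4 _ refl]) auto
qed

lemma poly_time_cover_of:
  assumes "\<And>x y. (x, y) \<in> X \<Longrightarrow> \<exists>js. y = map (\<lambda>j. vertex (Suc j)) js \<and> (\<forall>j\<in>set js. j < length (snd x))"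
  shows "poly_time_on X
    (\<lambda>(x, y). [inst_code set_cover_problem x, sol_code (temporal_separator_problem t) y])
    (\<lambda>(x, y). sol_code set_cover_problem (cover_of x y))"
\<comment> \<open>Decoding takes at most \<open>50 * k\<close> steps for the square
  \<open>k\<close>, so at most \<open>50 * k\<close> symbols are moved at cost 8 each; 460 leaves
  room for the remaining constant.\<close>
proof (rule poly_time_onI[where p = "Seq decode (move_all 3 0)" and q = "[:460:] * [:1, 1:] ^ 2"])
  fix z assume "z \<in> X"
  then obtain us fs js where z: "z = ((us, fs), map (\<lambda>j. vertex (Suc j)) js)"
    and js: "\<forall>j\<in>set js. j < length fs"
    using assms by (metis snd_conv surj_pair)
  let ?w = "code_prod (code_list code_nat) (code_list (code_list code_nat)) (us, fs)"
  let ?v = "code_list code_nat (map (\<lambda>j. vertex (Suc j)) js)"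
  let ?n = "50 * (length ?w + length ?v + 1) ^ 2"
  obtain \<rho> where \<rho>: "runs decode (load [?w, ?v]) ?n \<rho>" "\<rho> 0 = []"
    "\<rho> 3 = rev (code_list (code_list code_nat) (map ((!) fs) js))"
    using runs_decode[of "load [?w, ?v]" us fs js, OF _ _ _ _ js refl] by auto
  have len: "length (\<rho> 3) \<le> ?n"
    using runs_length_le[OF \<rho>(1), of 3] by simp
  have "50 * k + (8 * l + 1) \<le> 460 * k" if "l \<le> 50 * k" "1 \<le> k" for k l :: nat
    using that by linarith
  from this[OF len] have bound: "?n + (8 * length (\<rho> 3) + 1)
      \<le> poly ([:460:] * [:1, 1:] ^ 2) (sum_list (map length [?w, ?v]))"
    by (simp add: poly_mult poly_power add_ac)
  have run: "runs (Seq decode (move_all 3 0)) (load [?w, ?v]) (?n + (8 * length (\<rho> 3) + 1))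
      (\<rho>(3 := [], 0 := rev (\<rho> 3) @ \<rho> 0))"
    by (rule runs_Seq[OF \<rho>(1) runs_move_all]) simp
  have input: "(case z of (x, y) \<Rightarrow>
      [inst_code set_cover_problem x, sol_code (temporal_separator_problem t) y]) = [?w, ?v]"
    by (simp add: z set_cover_problem_def temporal_separator_problem_def)
  have "cover_of (us, fs) (map (\<lambda>j. vertex (Suc j)) js) = map ((!) fs) js"
    by (simp add: cover_of_def bits_of_vertex)
  then have "(\<rho>(3 := [], 0 := rev (\<rho> 3) @ \<rho> 0)) 0 =
      (case z of (x, y) \<Rightarrow> sol_code set_cover_problem (cover_of x y))"
    by (simp add: z \<rho> set_cover_problem_def)
  with runs_weaken[OF run bound refl]
  show "\<exists>\<sigma>. runs (Seq decode (move_all 3 0))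
      (load (case z of (x, y) \<Rightarrow> [inst_code set_cover_problem x, sol_code (temporal_separator_problem t) y]))
      (poly ([:460:] * [:1, 1:] ^ 2) (sum_list (map length (case z of (x, y) \<Rightarrow>
        [inst_code set_cover_problem x, sol_code (temporal_separator_problem t) y])))) \<sigma> \<and>
      \<sigma> 0 = (case z of (x, y) \<Rightarrow> sol_code set_cover_problem (cover_of x y))"
    unfolding input by blast
qed

section \<open>Separators and covers\<close>

lemma set_hits: "set (hits a j Ss) = {Suc (j + i) |i. i < length Ss \<and> a \<in> set (Ss ! i)}"
proof (induction Ss arbitrary: j)
  case (Cons S Ss)
  have split: "{Suc (j + i) |i. i < length (S # Ss) \<and> a \<in> set ((S # Ss) ! i)} =
      (if a \<in> set S then {Suc j} else {}) \<union> {Suc (Suc j + i) |i. i < length Ss \<and> a \<in> set (Ss ! i)}"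
    (is "?L = ?R")
  proof (rule set_eqI)
    show "p \<in> ?L \<longleftrightarrow> p \<in> ?R" for p
      by (auto simp: less_Suc_eq_0_disj)
  qed
  show ?case unfolding split using Cons.IH[of "Suc j"] by simp
qed simp

lemma distinct_hits: "distinct (hits a j Ss)"
  by (induction Ss arbitrary: j) (auto simp: set_hits)

lemma vertex_eq_iff: "vertex p = vertex q \<longleftrightarrow> p = q"
  by (metis bits_of_vertex length_replicate)

lemma vertex_0 [simp]: "vertex 0 = 0"
  by (simp add: vertex_def)

lemma vertex_eq_0_iff [simp]: "vertex p = 0 \<longleftrightarrow> p = 0" "0 = vertex p \<longleftrightarrow> p = 0"
  using vertex_eq_iff[of p 0] by auto

lemma vertex_neq_2: "vertex p \<noteq> 2"
proof
  assume "vertex p = 2"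
  then have "replicate p (Bit True) = [Bit False, Bit True]"
    by (metis bits_of_vertex bits_of_2)
  then show False by (cases p) auto
qed

lemma route_eq: "route fs a = map vertex (0 # hits a 0 fs) @ [2]"
  by (simp add: route_def)

lemma distinct_route: "distinct (route fs a)"
  by (auto simp: route_eq distinct_map inj_on_def vertex_eq_iff vertex_neq_2 distinct_hits set_hits)

lemma set_route: "set (route fs a) \<subseteq> insert 2 (vertex ` {..length fs})"
proof -
  have "set (0 # hits a 0 fs) \<subseteq> {..length fs}" by (auto simp: set_hits)
  then show ?thesis unfolding route_eq by auto
qed

text \<open>Distinct labels are apart by at least \<open>2 ^ t > t\<close>. A difference of
  \<open>t\<close> already suffices, because the travelling time counts both end points.\<close>

lemma time_of_gap: "a < b \<Longrightarrow> time_of t a + t \<le> time_of t b"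
proof -
  assume "a < b"
  then have "2 ^ t * (Suc (2 * a) + 1) \<le> 2 ^ t * Suc (2 * b)"
    by (intro mult_left_mono) auto
  then have "time_of t a + 2 ^ t \<le> time_of t b"
    by (simp add: time_of_def distrib_left)
  then show ?thesis using less_exp[of t] by linarith
qed

lemma time_of_pos: "1 \<le> time_of t a"
  by (simp add: time_of_def Suc_le_eq)

lemma ex_nat_split: "(\<exists>i. P i) \<longleftrightarrow> P 0 \<or> (\<exists>i. P (Suc i))"
  by (metis not0_implies_Suc)

lemma set_links: "(x, y, k) \<in> set (links l xs) \<longleftrightarrow> k = l \<and> (\<exists>i. Suc i < length xs \<and>
    (x = xs ! i \<and> y = xs ! Suc i \<or> x = xs ! Suc i \<and> y = xs ! i))"
proof (induction l xs rule: links.induct)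
  case (1 l u v xs)
  let ?Q = "\<lambda>i. Suc i < length (u # v # xs) \<and> (x = (u # v # xs) ! i \<and> y = (u # v # xs) ! Suc i \<or>
    x = (u # v # xs) ! Suc i \<and> y = (u # v # xs) ! i)"
  show ?case
    using 1 by (subst ex_nat_split[of ?Q]) auto
qed auto

lemma links_sym: "(x, y, k) \<in> set (links l xs) \<Longrightarrow> (y, x, k) \<in> set (links l xs)"
  by (induction l xs rule: links.induct) auto

lemma links_irrefl: "distinct xs \<Longrightarrow> (x, x, k) \<notin> set (links l xs)"
  by (induction l xs rule: links.induct) auto

lemma links_vertices: "(x, y, k) \<in> set (links l xs) \<Longrightarrow> x \<in> set xs \<and> y \<in> set xs"
  by (induction l xs rule: links.induct) auto

text \<open>Edges join neighbours on the route, so the only way out of the first \<open>i\<close>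
  vertices leads to position \<open>i\<close>. Since edges run in both directions, the invariant is
  membership in this initial segment and not a growing position.\<close>

lemma links_step:
  assumes "distinct xs" "(x, y, k) \<in> set (links l xs)" "i < length xs"
    and "x \<in> set (take i xs)" "y \<noteq> xs ! i"
  shows "y \<in> set (take i xs)"
proof -
  have take: "z \<in> set (take i xs) \<longleftrightarrow> (\<exists>n<i. z = xs ! n)" for z
    using assms(3) by (auto simp: in_set_conv_nth)
  obtain n where n: "n < i" "x = xs ! n" using assms(4) take by blast
  obtain m where m: "Suc m < length xs"
    "x = xs ! m \<and> y = xs ! Suc m \<or> x = xs ! Suc m \<and> y = xs ! m"
    using assms(2) set_links by metis
  from m(2) show ?thesis
  proof
    assume *: "x = xs ! m \<and> y = xs ! Suc m"
    then have "m = n" using n m assms(1,3) by (simp add: nth_eq_iff_index_eq)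
    moreover from this have "Suc m \<noteq> i" using * assms(5) by blast
    ultimately have "Suc m < i" using n by simp
    then show ?thesis using * take by blast
  next
    assume *: "x = xs ! Suc m \<and> y = xs ! m"
    then have "Suc m = n" using n m assms(1,3) by (simp add: nth_eq_iff_index_eq)
    then have "m < i" using n by simp
    then show ?thesis using * take by blast
  qed
qed

section \<open>Separators as hitting sets of the routes\<close>

definition edges_of :: "nat \<Rightarrow> nat list \<Rightarrow> nat list list \<Rightarrow> nat tedge list" where
  "edges_of t us fs = concat (map (\<lambda>a. links (time_of t a) (route fs a)) (rev us))"

lemma set_edges_of:
  "(x, y, k) \<in> set (edges_of t us fs) \<longleftrightarrow>
    (\<exists>a\<in>set us. k = time_of t a \<and> (x, y, k) \<in> set (links (time_of t a) (route fs a)))"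
  by (auto simp: edges_of_def set_links)

context
  fixes G :: "nat tgraph" and t :: nat and us :: "nat list" and fs :: "nat list list"
  assumes edges: "tedges G = set (edges_of t us fs)" and t: "t > 0"
begin

text \<open>Walked at its single label, the route has travelling time 1, which is at most
  \<open>t\<close> as \<open>t > 0\<close>. A separator must meet it but avoids both terminals, so
  it meets the vertex of a set.\<close>

lemma separator_meets_hits:
  assumes "temporal_separator G 0 2 t S" and "a \<in> set us"
  shows "\<exists>p\<in>set (hits a 0 fs). vertex p \<in> S"
proof -
  let ?P = "route fs a" and ?l = "time_of t a"
  define es where "es = map (\<lambda>i. (?P ! i, ?P ! Suc i, ?l)) [0..<length ?P - 1]"
  have len: "length ?P = Suc (Suc (length (hits a 0 fs)))" by (simp add: route_def)
  have es: "length es = length ?P - 1" "es \<noteq> []"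
    and nth: "\<And>i. i < length ?P - 1 \<Longrightarrow> es ! i = (?P ! i, ?P ! Suc i, ?l)"
    by (simp_all add: es_def len del: upt_Suc)
  have hd: "hd es = (?P ! 0, ?P ! 1, ?l)" using es nth[of 0] len by (simp add: hd_conv_nth)
  have last: "last es = (?P ! (length ?P - 2), ?P ! (length ?P - 1), ?l)"
    using es nth[of "length ?P - 2"] len by (simp add: last_conv_nth)
  have verts: "path_verts es = ?P"
  proof (rule nth_equalityI)
    show "length (path_verts es) = length ?P" using es len by (simp add: path_verts_def)
    show "path_verts es ! i = ?P ! i" if "i < length (path_verts es)" for i
      using that es nth len by (cases i) (auto simp: path_verts_def hd tail_def head_def)
  qed
  have "temporal_path G 0 2 es"
    unfolding temporal_path_def verts
  proof (intro conjI allI impI)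
    show "set es \<subseteq> tedges G"
    proof
      fix e assume "e \<in> set es"
      then obtain i where "i < length ?P - 1" "e = (?P ! i, ?P ! Suc i, ?l)" by (auto simp: es_def)
      then have "e \<in> set (links ?l ?P)" unfolding \<open>e = _\<close> set_links by (auto intro!: exI[of _ i])
      then show "e \<in> tedges G" using assms(2) by (auto simp: edges edges_of_def)
    qed
    show "sorted (map label es)" by (simp add: es_def label_def comp_def sorted_map)
    show "head (last es) = 2" by (simp add: last head_def route_def nth_append)
  qed (use es nth len distinct_route in \<open>auto simp: hd tail_def head_def route_def\<close>)
  then have "bounded_temporal_path G 0 2 t es"
    using t by (simp add: bounded_temporal_path_def travelling_time_def hd last label_def)
  then have "S \<inter> set ?P \<noteq> {}" "S \<inter> {0, 2} = {}"
    using assms(1) unfolding temporal_separator_def verts[symmetric] by blast+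
  then show ?thesis by (auto simp: route_def)
qed

text \<open>A path that is fast enough keeps the label of its first edge, and hence stays on the
  route of one element \<open>a\<close>; the vertex in \<open>S\<close> on this route then blocks
  it.\<close>

lemma hitting_set_separates:
  assumes "S \<subseteq> verts G - {0, 2}" and "\<And>a. a \<in> set us \<Longrightarrow> \<exists>p\<in>set (hits a 0 fs). vertex p \<in> S"
  shows "temporal_separator G 0 2 t S"
  unfolding temporal_separator_def
proof (intro conjI allI impI, rule assms(1))
  fix es assume "bounded_temporal_path G 0 2 t es"
  then have es: "es \<noteq> []" "set es \<subseteq> tedges G" "tail (hd es) = 0" "head (last es) = 2"
    "\<And>i. Suc i < length es \<Longrightarrow> head (es ! i) = tail (es ! Suc i)" "sorted (map label es)"
    "label (last es) - label (hd es) + 1 \<le> t"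
    by (auto simp: bounded_temporal_path_def temporal_path_def travelling_time_def)
  have in_edges: "\<exists>b\<in>set us. label e = time_of t b \<and>
      (tail e, head e, label e) \<in> set (links (time_of t b) (route fs b))" if "e \<in> set es" for e
  proof -
    obtain x y k where e: "e = (x, y, k)" by (cases e)
    then have "(x, y, k) \<in> set (edges_of t us fs)" using that es(2) edges by auto
    then show ?thesis
      unfolding set_edges_of by (simp add: e label_def tail_def head_def)
  qed
  obtain a where a: "a \<in> set us" "label (hd es) = time_of t a"
    using in_edges[of "hd es"] es(1) by auto
  have walk: "(tail e, head e, label e) \<in> set (links (time_of t a) (route fs a))"
    if e: "e \<in> set es" for e
  proof -
    obtain b where b: "b \<in> set us" "label e = time_of t b"
      "(tail e, head e, label e) \<in> set (links (time_of t b) (route fs b))"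
      using in_edges[OF e] by blast
    obtain i where i: "i < length es" "e = es ! i" using e by (auto simp: in_set_conv_nth)
    have "label (hd es) \<le> label e" "label e \<le> label (last es)"
      using sorted_nth_mono[OF es(6), of 0 i] sorted_nth_mono[OF es(6), of i "length es - 1"] i es(1)
      by (auto simp: hd_conv_nth last_conv_nth)
    \<comment> \<open>Otherwise the two labels differ by at least \<open>t\<close>, while both lie
      between the first and the last label of the path, which differ by less than
      \<open>t\<close>.\<close>
    then have "b = a"
      using time_of_gap[of a b t] time_of_gap[of b a t] a(2) b(2) es(7) t by (cases a b rule: linorder_cases) auto
    then show ?thesis using b by simp
  qed
  obtain p where p: "p \<in> set (hits a 0 fs)" "vertex p \<in> S" using assms(2)[OF a(1)] by blast
  let ?P = "route fs a"
  have "vertex p \<in> set (butlast ?P)" "vertex p \<noteq> 0"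
    using p assms(1) by (auto simp: route_def butlast_append)
  then obtain i where i: "i < length ?P - 1" "?P ! i = vertex p"
    by (auto simp: in_set_conv_nth nth_butlast)
  have "i > 0"
    using i(2) \<open>vertex p \<noteq> 0\<close> by (cases i) (auto simp: route_def)
  show "S \<inter> set (path_verts es) \<noteq> {}"
  proof
    assume "S \<inter> set (path_verts es) = {}"
    moreover have "head e \<in> set (path_verts es)" if "e \<in> set es" for e
      using that by (simp add: path_verts_def)
    ultimately have avoid: "head e \<noteq> ?P ! i" if "e \<in> set es" for e
      using that p(2) unfolding i(2) by (metis disjoint_iff)
    have start: "0 \<in> set (take i ?P)" using \<open>i > 0\<close> by (cases i) (auto simp: route_def)
    \<comment> \<open>The walk starts before position \<open>i\<close> and never enters the vertex
      there, so it stays before it; \<open>z\<close>, the last vertex of the route, is out of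
      reach.\<close>
    have "head (es ! n) \<in> set (take i ?P)" if "n < length es" for n
      using that
    proof (induction n)
      case 0
      then have "es ! 0 \<in> set es" by simp
      from links_step[OF distinct_route walk[OF this] _ _ avoid[OF this]] show ?case
        using i start es(1,3) by (simp add: hd_conv_nth)
    next
      case (Suc n)
      then have "es ! Suc n \<in> set es" by simp
      from links_step[OF distinct_route walk[OF this] _ _ avoid[OF this]] show ?case
        using i Suc es(5)[of n] by simp
    qed
    from this[of "length es - 1"] have "2 \<in> set (take i ?P)"
      using es(1,4) by (simp add: last_conv_nth)
    moreover have "set (take i ?P) \<subseteq> set (butlast ?P)"
      using i by (auto simp: butlast_conv_take intro: set_take_subset_set_take[THEN subsetD, rotated])
    moreover have "2 \<notin> set (butlast ?P)"
      using distinct_route[of fs a] by (simp add: route_def butlast_append)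
    ultimately show False by blast
  qed
qed

end

lemma temporal_graph_reduce:
  assumes "reduce t (us, fs) = (vs, es, \<tau>, s, z)"
  shows "temporal_graph (graph_of vs es \<tau>)"
proof -
  have eq: "vs = 0 # 2 # map vertex [1..<Suc (length fs)]" "es = edges_of t us fs"
    "\<tau> = vertex (length (concat (map code_nat us)) + Suc t)"
    using assms by (auto simp: reduce_def edges_of_def)
  have vs: "set vs = insert 2 (vertex ` {..length fs})"
  proof -
    have "{..length fs} = insert 0 {1..<Suc (length fs)}" by auto
    then show ?thesis by (simp add: eq insert_commute del: upt_Suc)
  qed
  \<comment> \<open>The label has \<open>t + 1\<close> digits more than \<open>a\<close>, hence no
    more digits than the lifetime has ones.\<close>
  have label: "time_of t a \<in> {1..\<tau>}" if "a \<in> set us" for a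
  proof -
    have "length (code_nat a) \<le> length (concat (map code_nat us))"
      using that by (induction us) auto
    then have "length (bits_of (time_of t a)) \<le> length (concat (map code_nat us)) + Suc t"
      by (simp add: bits_of_time_of code_nat_def)
    then have "(2::nat) ^ length (bits_of (time_of t a)) \<le> 2 ^ (length (concat (map code_nat us)) + Suc t)"
      by (rule power_increasing) simp
    then have "time_of t a < 2 ^ (length (concat (map code_nat us)) + Suc t)"
      using less_two_power_length_bits_of[of "time_of t a"] by linarith
    then show ?thesis using time_of_pos[of t a] unfolding eq(3) vertex_def by simp
  qed
  show ?thesis
    unfolding temporal_graph_def
  proof (intro conjI allI)
    show "tedges (graph_of vs es \<tau>) \<subseteq>
        verts (graph_of vs es \<tau>) \<times> verts (graph_of vs es \<tau>) \<times> {1..lifetime (graph_of vs es \<tau>)}"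
    proof
      fix e assume "e \<in> tedges (graph_of vs es \<tau>)"
      then obtain x y k where e: "e = (x, y, k)" "(x, y, k) \<in> set (edges_of t us fs)"
        by (cases e) (auto simp: graph_of_def eq(2))
      then obtain a where a: "a \<in> set us" "k = time_of t a"
        "(x, y, k) \<in> set (links (time_of t a) (route fs a))"
        unfolding set_edges_of by blast
      then have "x \<in> set vs" "y \<in> set vs"
        using links_vertices set_route[of fs a] vs by blast+
      then show "e \<in> verts (graph_of vs es \<tau>) \<times> verts (graph_of vs es \<tau>) \<times>
          {1..lifetime (graph_of vs es \<tau>)}"
        using label[OF a(1)] by (simp add: e a(2) graph_of_def)
    qed
    show "(u, v, i) \<in> tedges (graph_of vs es \<tau>) \<longleftrightarrow> (v, u, i) \<in> tedges (graph_of vs es \<tau>)" for u v i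
      unfolding graph_of_def eq(2) using links_sym by (simp add: set_edges_of) blast
    show "(u, u, i) \<notin> tedges (graph_of vs es \<tau>)" for u i
      by (simp add: graph_of_def eq(2) set_edges_of links_irrefl distinct_route)
  qed (simp add: graph_of_def)
qed

section \<open>Optima and ratios\<close>

lemma ratio_mono: "c \<le> c' \<Longrightarrow> ratio c m \<le> ratio c' m"
  by (simp add: ratio_def divide_right_mono)

lemma opt_le:
  assumes "y \<in> feasible P x"
  shows "opt P x \<le> cost P x y"
  unfolding opt_def by (rule cINF_lower) (use assms in auto)

lemma opt_attained:
  assumes "feasible P x \<noteq> {}"
  obtains y where "y \<in> feasible P x" "cost P x y = opt P x"
proof -
  have "opt P x \<in> cost P x ` feasible P x"
    unfolding opt_def by (rule Inf_nat_def1) (use assms in simp)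
  then show ?thesis using that by auto
qed

text \<open>Solution maps in both directions that do not increase the cost force the two optima to coincide.\<close>

lemma strict_reductionI:
  assumes "\<And>x. x \<in> instances P \<Longrightarrow> f x \<in> instances Q"
    and forward: "\<And>x c. x \<in> instances P \<Longrightarrow> c \<in> feasible P x \<Longrightarrow>
      \<exists>y\<in>feasible Q (f x). cost Q (f x) y \<le> cost P x c"
    and backward: "\<And>x y. x \<in> instances P \<Longrightarrow> y \<in> feasible Q (f x) \<Longrightarrow>
      g x y \<in> feasible P x \<and> cost P x (g x y) \<le> cost Q (f x) y"
  shows "strict_reduction P Q f g"
  unfolding strict_reduction_def
proof (intro ballI conjI impI)
  fix x assume x: "x \<in> instances P"
  show "f x \<in> instances Q" using assms(1) x .
  show "feasible Q (f x) \<noteq> {}" if "feasible P x \<noteq> {}" using that forward[OF x] by blast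
  fix y assume y: "y \<in> feasible Q (f x)"
  show gy: "g x y \<in> feasible P x" using backward[OF x y] by simp
  obtain c where c: "c \<in> feasible P x" "cost P x c = opt P x"
    by (rule opt_attained[of P x]) (use gy in auto)
  obtain y' where y': "y' \<in> feasible Q (f x)" "cost Q (f x) y' = opt Q (f x)"
    by (rule opt_attained[of Q "f x"]) (use y in auto)
  have "opt P x \<le> opt Q (f x)"
    using backward[OF x y'(1)] opt_le[of "g x y'" P x] y'(2) by simp
  moreover have "opt Q (f x) \<le> opt P x"
    using forward[OF x c(1)] opt_le[of _ Q "f x"] c(2) le_trans by metis
  ultimately show "ratio (cost P x (g x y)) (opt P x) \<le> ratio (cost Q (f x) y) (opt Q (f x))"
    using backward[OF x y] by (simp add: ratio_mono)
qed

section \<open>Translating solutions\<close>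

lemma separator_coordinates:
  assumes "ys \<in> feasible (temporal_separator_problem t) (reduce t (us, fs))"
  shows "\<exists>js. ys = map (\<lambda>j. vertex (Suc j)) js \<and> (\<forall>j\<in>set js. j < length fs)"
proof -
  have "set ys \<subseteq> insert 0 (insert 2 (vertex ` {1..<Suc (length fs)})) - {0, 2}"
    using assms by (auto simp: temporal_separator_problem_def reduce_def temporal_separator_def
        graph_of_def simp del: upt_Suc)
  also have "{1..<Suc (length fs)} = Suc ` {..<length fs}"
    by (simp add: image_Suc_lessThan atLeastLessThanSuc_atLeastAtMost)
  finally have "set ys \<subseteq> (\<lambda>j. vertex (Suc j)) ` {..<length fs}" by auto
  then show ?thesis
  proof (induction ys)
    case (Cons y ys)
    then obtain js j where "ys = map (\<lambda>j. vertex (Suc j)) js" "\<forall>j\<in>set js. j < length fs"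
      "y = vertex (Suc j)" "j < length fs" by auto
    then show ?case by (intro exI[of _ "j # js"]) simp
  qed simp
qed

lemma reduce_graph:
  "feasible (temporal_separator_problem t) (reduce t (us, fs)) =
     {ys. temporal_separator (graph_of (0 # 2 # map vertex [1..<Suc (length fs)]) (edges_of t us fs)
       (vertex (length (concat (map code_nat us)) + Suc t))) 0 2 t (set ys)}"
  by (simp add: temporal_separator_problem_def reduce_def edges_of_def del: upt_Suc)

lemma cover_of_separator:
  assumes "t > 0" "set_system (set us) (set ` set fs)"
    and "ys \<in> feasible (temporal_separator_problem t) (reduce t (us, fs))"
  shows "set_cover (set us) (set ` set fs) (set ` set (cover_of (us, fs) ys))"
proof -
  obtain js where js: "ys = map (\<lambda>j. vertex (Suc j)) js" "\<forall>j\<in>set js. j < length fs"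
    using separator_coordinates[OF assms(3)] by blast
  have cover: "cover_of (us, fs) ys = map ((!) fs) js"
    by (simp add: cover_of_def js(1) bits_of_vertex)
  have sub: "set ` set (map ((!) fs) js) \<subseteq> set ` set fs" using js(2) by auto
  have meets: "\<exists>j\<in>set js. a \<in> set (fs ! j)" if a: "a \<in> set us" for a
  proof -
    obtain p where "p \<in> set (hits a 0 fs)" "vertex p \<in> set ys"
      using separator_meets_hits[OF _ assms(1) assms(3)[unfolded reduce_graph mem_Collect_eq] a]
      by (auto simp: graph_of_def)
    then show ?thesis by (auto simp: set_hits js(1) vertex_eq_iff)
  qed
  have "\<Union>(set ` set fs) = set us" using assms(2) by (simp add: set_system_def)
  then have "\<Union>(set ` set (map ((!) fs) js)) \<subseteq> set us" using sub by blast
  moreover have "set us \<subseteq> \<Union>(set ` set (map ((!) fs) js))" using meets by auto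
  ultimately have "\<Union>(set ` set (map ((!) fs) js)) = set us" by (rule equalityI)
  with sub show ?thesis unfolding set_cover_def cover by (rule conjI)
qed

text \<open>The family may list a set several times, as different vertices. Choosing one position
  \<open>index c\<close> for each set \<open>c\<close> of the cover keeps the separator no larger
  than the cover.\<close>

lemma separator_of_cover:
  assumes "t > 0" "set_cover (set us) (set ` set fs) (set ` set cs)"
  shows "\<exists>ys\<in>feasible (temporal_separator_problem t) (reduce t (us, fs)).
    card (set ys) \<le> card (set ` set cs)"
proof -
  let ?C = "set ` set cs"
  have cover: "?C \<subseteq> set ` set fs" "\<Union>?C = set us"
    using assms(2) by (simp_all only: set_cover_def)
  have "\<exists>i<length fs. set (fs ! i) = c" if "c \<in> ?C" for c
  proof -
    have "c \<in> set ` set fs" using cover(1) that by (rule subsetD)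
    then obtain S where "S \<in> set fs" "c = set S" by (rule imageE)
    then show ?thesis by (metis in_set_conv_nth)
  qed
  then obtain index where index: "\<And>c. c \<in> ?C \<Longrightarrow> index c < length fs \<and> set (fs ! index c) = c"
    by metis
  obtain ys where ys: "set ys = (\<lambda>c. vertex (Suc (index c))) ` ?C"
    using finite_list[of "(\<lambda>c. vertex (Suc (index c))) ` ?C"] by auto
  have "ys \<in> feasible (temporal_separator_problem t) (reduce t (us, fs))"
    unfolding reduce_graph mem_Collect_eq
  proof (rule hitting_set_separates[OF _ assms(1)])
    show "tedges (graph_of (0 # 2 # map vertex [1..<Suc (length fs)]) (edges_of t us fs)
        (vertex (length (concat (map code_nat us)) + Suc t))) = set (edges_of t us fs)"
      by (simp add: graph_of_def)
    have "vertex (Suc (index c)) \<in> vertex ` {1..<Suc (length fs)}" if "c \<in> ?C" for c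
      using index[OF that] by simp
    then show "set ys \<subseteq> verts (graph_of (0 # 2 # map vertex [1..<Suc (length fs)]) (edges_of t us fs)
        (vertex (length (concat (map code_nat us)) + Suc t))) - {0, 2}"
      unfolding ys by (auto simp: graph_of_def vertex_neq_2 simp del: upt_Suc)
    fix a assume "a \<in> set us"
    then obtain c where c: "c \<in> ?C" "a \<in> c"
      using cover(2) by (metis UnionE)
    then show "\<exists>p\<in>set (hits a 0 fs). vertex p \<in> set ys"
      unfolding ys set_hits using index[OF c(1)]
      by (intro bexI[of _ "Suc (index c)"]) auto
  qed
  moreover have "card (set ys) \<le> card ?C" unfolding ys by (rule card_image_le) simp
  ultimately show ?thesis by blast
qed

theorem theorem3:
  fixes t :: nat
  assumes "t > 0"
  shows "strict_poly_time_reducible set_cover_problem (temporal_separator_problem t)"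
  unfolding strict_poly_time_reducible_def
proof (intro exI conjI)
  show "strict_reduction set_cover_problem (temporal_separator_problem t) (reduce t) cover_of"
  proof (rule strict_reductionI)
    fix x assume x: "x \<in> instances set_cover_problem"
    obtain us fs where x_eq: "x = (us, fs)" by force
    have sys: "set_system (set us) (set ` set fs)" using x by (simp add: x_eq set_cover_problem_def)
    show "reduce t x \<in> instances (temporal_separator_problem t)"
      using temporal_graph_reduce[of t us fs]
      by (auto simp: x_eq temporal_separator_problem_def reduce_def simp del: upt_Suc)
    show "\<exists>y\<in>feasible (temporal_separator_problem t) (reduce t x).
        cost (temporal_separator_problem t) (reduce t x) y \<le> cost set_cover_problem x c"
      if "c \<in> feasible set_cover_problem x" for c
      using separator_of_cover[OF assms, of us fs c] that
      by (auto simp: x_eq set_cover_problem_def temporal_separator_problem_def)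
    show "cover_of x y \<in> feasible set_cover_problem x \<and>
        cost set_cover_problem x (cover_of x y) \<le> cost (temporal_separator_problem t) (reduce t x) y"
      if y: "y \<in> feasible (temporal_separator_problem t) (reduce t x)" for y
    proof
      show "cover_of x y \<in> feasible set_cover_problem x"
        using cover_of_separator[OF assms sys] y by (simp add: x_eq set_cover_problem_def)
      \<comment> \<open>The subfamily is an image of the set of separator vertices, so the cost
        cannot grow; vertices that present the same set are merged.\<close>
      have "set ` set (cover_of x y) = (\<lambda>v. set (snd x ! (length (bits_of v) - 1))) ` set y"
        by (simp add: cover_of_def image_image)
      then show "cost set_cover_problem x (cover_of x y) \<le> cost (temporal_separator_problem t) (reduce t x) y"
        by (simp add: set_cover_problem_def temporal_separator_problem_def card_image_le)
    qed
  qed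
  show "poly_time_on (instances set_cover_problem) (\<lambda>x. [inst_code set_cover_problem x])
      (\<lambda>x. inst_code (temporal_separator_problem t) (reduce t x))"
    by (rule poly_time_reduce)
  show "poly_time_on {(x, y). x \<in> instances set_cover_problem \<and>
        y \<in> feasible (temporal_separator_problem t) (reduce t x)}
      (\<lambda>(x, y). [inst_code set_cover_problem x, sol_code (temporal_separator_problem t) y])
      (\<lambda>(x, y). sol_code set_cover_problem (cover_of x y))"
    by (rule poly_time_cover_of) (use separator_coordinates in auto)
qed

end
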